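(* Let $F_1,F_2$ be regular flows on the plane $\mathbb{R}^2$ and denote by $\mathcal{F}_1,\mathcal{F}_2$ the corresponding spaces of orbits endowed with the quotient topology induced by the projections $\mathbb{R}^2\to\mathcal{F}_i$, $x\mapsto\mathcal{O}_{F_i}(x)$. Then $F_1$ and $F_2$ are topologically equivalent if and only if there is a homeomorphism $\phi:\mathcal{F}_1\to\mathcal{F}_2$ that preserves the relation $\succ$, namely such that $\mathcal{O}_{F_1}(x_1)\succ\mathcal{O}_{F_1}(x_2)$ if and only if $\phi(\mathcal{O}_{F_1}(x_1))\succ\phi(\mathcal{O}_{F_1}(x_2))$ for every $x_1,x_2\in\mathbb{R}^2$.
   Context: A flow on $X=\mathbb{R}^2$ is a continuous map $F:\mathbb{R}\times X\to X$, $(t,x)\mapsto F^t(x)$, with $F^t(F^s(x))=F^{t+s}(x)$ and $F^0(x)=x$. The orbit of $q$ is $\mathcal{O}_F(q)=\{F^t(q):t\in\mathbb{R}\}$ and its forward orbit is $\mathcal{O}^+_F(q)=\{F^t(q):t\ge0\}$. Regular flow: $F$ is regular if it is locally topologically equivalent to the flow $G$ of a constant nonzero vector field, i.e. for every $p$ there are an open neighborhood $U_p$ of $p$ and a homeomorphism $\phi_p:U_p\to\mathbb{R}^2$ such that $\phi_p(\mathcal{O}_F(q)\cap U_p)=\mathcal{O}_G(\phi_p(q))$ for every $q\in U_p$. Two flows are topologically equivalent if there is a homeomorphism of $\mathbb{R}^2$ onto itself (not required to preserve the orientation of the plane) that sends orbits of the first to orbits of the second and preserves the orientation (time direction) of the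 orbits. The prolongational relation $\mathcal{P}_F$ is the closure in $X\times X$ of $\{(p,q):q\in\mathcal{O}^+_F(p)\}$; write $p\succcurlyeq_{\mathcal{P}_F}q$ if $(p,q)\in\mathcal{P}_F$. A set is saturated if it is a union of orbits. Two distinct orbits $s_1,s_2$ of $F$ are inseparable if every saturated neighborhood of $s_1$ meets every saturated neighborhood of $s_2$. For orbits $s_1,s_2$ of $F$, $s_1\succ s_2$ means that $s_1,s_2$ are distinct and inseparable and $p\succcurlyeq_{\mathcal{P}_F}q$ for some $p\in s_1$, $q\in s_2$ (equivalently, for all such $p,q$). *)

theory Defs
  imports "HOL-Analysis.Analysis"
begin

type_synonym plane = "real ^ 2"

definition flow :: "(real \<Rightarrow> plane \<Rightarrow> plane) \<Rightarrow> bool" where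
  "flow F \<longleftrightarrow>
     continuous_on UNIV (\<lambda>(t, x). F t x) \<and>
     (\<forall>s t x. F t (F s x) = F (t + s) x) \<and>
     (\<forall>x. F 0 x = x)"

definition orbit :: "(real \<Rightarrow> plane \<Rightarrow> plane) \<Rightarrow> plane \<Rightarrow> plane set" where
  "orbit F q = {F t q |t. True}"

definition forward_orbit :: "(real \<Rightarrow> plane \<Rightarrow> plane) \<Rightarrow> plane \<Rightarrow> plane set" where
  "forward_orbit F q = {F t q |t. t \<ge> 0}"

definition orbits :: "(real \<Rightarrow> plane \<Rightarrow> plane) \<Rightarrow> plane set set" where
  "orbits F = range (orbit F)"

definition constant_field_flow :: "plane \<Rightarrow> real \<Rightarrow> plane \<Rightarrow> plane" where
  "constant_field_flow v t x = x + t *\<^sub>R v"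

definition regular_flow :: "(real \<Rightarrow> plane \<Rightarrow> plane) \<Rightarrow> bool" where
  "regular_flow F \<longleftrightarrow> flow F \<and>
     (\<exists>v. v \<noteq> 0 \<and>
       (\<forall>p. \<exists>U \<phi> \<psi>. open U \<and> p \<in> U \<and> homeomorphism U UNIV \<phi> \<psi> \<and>
          (\<forall>q\<in>U. \<phi> ` (orbit F q \<inter> U) = orbit (constant_field_flow v) (\<phi> q))))"

text \<open>Preservation of the time direction is expressed by an increasing change of time
  on each orbit. Asking only that forward orbits go to forward orbits would say nothing
  about a periodic orbit.\<close>

definition preserves_orbit_orientation ::
    "(real \<Rightarrow> plane \<Rightarrow> plane) \<Rightarrow> (real \<Rightarrow> plane \<Rightarrow> plane) \<Rightarrow> (plane \<Rightarrow> plane) \<Rightarrow> bool" where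
  "preserves_orbit_orientation F1 F2 h \<longleftrightarrow>
     (\<forall>x. \<exists>\<tau>::real \<Rightarrow> real. continuous_on UNIV \<tau> \<and> strict_mono \<tau> \<and>
        (\<forall>t. h (F1 t x) = F2 (\<tau> t) (h x)))"

definition topologically_equivalent ::
    "(real \<Rightarrow> plane \<Rightarrow> plane) \<Rightarrow> (real \<Rightarrow> plane \<Rightarrow> plane) \<Rightarrow> bool" where
  "topologically_equivalent F1 F2 \<longleftrightarrow>
     (\<exists>h g. homeomorphism UNIV UNIV h g \<and>
        (\<forall>s\<in>orbits F1. h ` s \<in> orbits F2) \<and>
        preserves_orbit_orientation F1 F2 h)"

definition prolongation :: "(real \<Rightarrow> plane \<Rightarrow> plane) \<Rightarrow> (plane \<times> plane) set" where
  "prolongation F = closure {(p, q). q \<in> forward_orbit F p}"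

definition saturated :: "(real \<Rightarrow> plane \<Rightarrow> plane) \<Rightarrow> plane set \<Rightarrow> bool" where
  "saturated F A \<longleftrightarrow> (\<exists>C. C \<subseteq> orbits F \<and> A = \<Union>C)"

definition saturated_nbhd ::
    "(real \<Rightarrow> plane \<Rightarrow> plane) \<Rightarrow> plane set \<Rightarrow> plane set \<Rightarrow> bool" where
  "saturated_nbhd F s N \<longleftrightarrow> saturated F N \<and> (\<exists>U. open U \<and> s \<subseteq> U \<and> U \<subseteq> N)"

definition inseparable ::
    "(real \<Rightarrow> plane \<Rightarrow> plane) \<Rightarrow> plane set \<Rightarrow> plane set \<Rightarrow> bool" where
  "inseparable F s1 s2 \<longleftrightarrow> s1 \<noteq> s2 \<and>
     (\<forall>N1 N2. saturated_nbhd F s1 N1 \<longrightarrow> saturated_nbhd F s2 N2 \<longrightarrow> N1 \<inter> N2 \<noteq> {})"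

definition orbit_succ ::
    "(real \<Rightarrow> plane \<Rightarrow> plane) \<Rightarrow> plane set \<Rightarrow> plane set \<Rightarrow> bool" where
  "orbit_succ F s1 s2 \<longleftrightarrow>
     s1 \<in> orbits F \<and> s2 \<in> orbits F \<and> inseparable F s1 s2 \<and>
     (\<exists>p\<in>s1. \<exists>q\<in>s2. (p, q) \<in> prolongation F)"

definition orbit_space :: "(real \<Rightarrow> plane \<Rightarrow> plane) \<Rightarrow> plane set topology" where
  "orbit_space F = topology (\<lambda>\<U>. \<U> \<subseteq> orbits F \<and> open {x. orbit F x \<in> \<U>})"

lemma openin_orbit_space:
  "openin (orbit_space F) \<U> \<longleftrightarrow> \<U> \<subseteq> orbits F \<and> open {x. orbit F x \<in> \<U>}"
proof -
  have "istopology (\<lambda>\<U>. \<U> \<subseteq> orbits F \<and> open {x. orbit F x \<in> \<U>})"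
    unfolding istopology_def
  proof (intro conjI allI impI)
    fix \<U> \<V>
    assume "\<U> \<subseteq> orbits F \<and> open {x. orbit F x \<in> \<U>}"
      and "\<V> \<subseteq> orbits F \<and> open {x. orbit F x \<in> \<V>}"
    then show "\<U> \<inter> \<V> \<subseteq> orbits F" "open {x. orbit F x \<in> \<U> \<inter> \<V>}"
      by (auto simp: open_Collect_conj)
  next
    fix \<K> :: "plane set set set"
    assume *: "\<forall>K\<in>\<K>. K \<subseteq> orbits F \<and> open {x. orbit F x \<in> K}"
    then show "\<Union>\<K> \<subseteq> orbits F" by blast
    have "{x. orbit F x \<in> \<Union>\<K>} = (\<Union>K\<in>\<K>. {x. orbit F x \<in> K})" by blast
    with * show "open {x. orbit F x \<in> \<Union>\<K>}" by auto
  qed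
  then show ?thesis by (simp add: orbit_space_def topology_inverse')
qed

lemma topspace_orbit_space: "topspace (orbit_space F) = orbits F"
proof
  show "topspace (orbit_space F) \<subseteq> orbits F"
    by (metis openin_orbit_space openin_topspace)
  have "openin (orbit_space F) (orbits F)"
    by (simp add: openin_orbit_space orbits_def)
  then show "orbits F \<subseteq> topspace (orbit_space F)"
    by (rule openin_subset)
qed

lemma quotient_map_orbit: "quotient_map euclidean (orbit_space F) (orbit F)"
  by (auto simp: quotient_map_def topspace_orbit_space openin_orbit_space orbits_def)

end

theory Submission
  imports Defs
begin

text \<open>
  Orbits of a regular flow are closed, and by Brouwer's theorem none of them is periodic, so
  that a cross section sweeps out an open tube. Every orbit separates the plane, which makes
  \<open>\<succ>\<close> antisymmetric.

  Given \<open>\<phi>\<close>, consider the space of pairs \<open>(p, q)\<close> such that \<open>\<phi>\<close> maps the orbit of \<open>p\<close> to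
  that of \<open>q\<close>, and order each product of two corresponding orbits by letting \<open>p\<close> move forwards
  and \<open>q\<close> move backwards. A limit of comparable pairs could be a pair on different products only
  if the orbits \<open>s\<close>, \<open>s'\<close> in the first plane satisfied \<open>s \<succ> s'\<close> and those in the second plane
  \<open>\<phi> s' \<succ> \<phi> s\<close>. As \<open>\<phi>\<close> preserves \<open>\<succ>\<close>, this is excluded: the order is closed. Hence bump functions
  supported in tubes can be made monotone without losing continuity, and a countable sum of them
  is a continuous function \<open>K\<close>, strictly increasing in \<open>p\<close>, strictly decreasing in \<open>q\<close>, with
  a zero on every line \<open>{p} \<times> \<phi> (orbit of p)\<close>. Its zero set is the graph of the homeomorphism.
\<close>

section \<open>Regular flows have no periodic orbits\<close>

text \<open>A homeomorphism of orbit spaces matches orbits but gives no parametrisation along them.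
  Over a tube a match is easy to find: compare the times measured from two corresponding cross
  sections. The obstacle is the gluing. The orbit space need not be Hausdorff, and a function on a
  tube, extended by zero, can jump at orbits inseparable from those of the tube. So the gluing takes
  place on the space of pairs, a subset of a Euclidean space of dimension four. A bump whose support
  is a whole quadrant in each product of orbits (all later \<open>p\<close>, all earlier
  \<open>q\<close>) is monotone, and closedness of the order keeps limits of its support in the same
  product. Reversing the order on the side of \<open>q\<close> is what makes a direction preserving
  match a level set: with \<open>K\<close> increasing in \<open>p\<close> and decreasing in
  \<open>q\<close>, zeros move forwards together. Bumps on the opposite quadrants enter with a minus
  sign, since a sum of nonnegative bumps that is positive everywhere would have no zero.\<close>

locale regular_plane_flow =
  fixes F :: "real \<Rightarrow> plane \<Rightarrow> plane"
  assumes regular: "regular_flow F"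
begin

lemma flow_add [simp]: "F t (F s x) = F (t + s) x"
  and flow_zero [simp]: "F 0 x = x"
  and continuous_flow: "continuous_on UNIV (\<lambda>(t, x). F t x)"
  using regular by (auto simp: regular_flow_def flow_def)

lemma continuous_on_flow [continuous_intros]:
  assumes "continuous_on S f" "continuous_on S g"
  shows "continuous_on S (\<lambda>x. F (f x) (g x))"
  using continuous_on_compose2[OF continuous_flow continuous_on_Pair[OF assms]] by simp

lemma tendsto_flow [tendsto_intros]:
  assumes "(f \<longlongrightarrow> a) G" "(g \<longlongrightarrow> b) G"
  shows "((\<lambda>x. F (f x) (g x)) \<longlongrightarrow> F a b) G"
proof -
  have "isCont (\<lambda>(t, x). F t x) (a, b)"
    using continuous_flow by (simp add: continuous_on_eq_continuous_at)
  then show ?thesis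
    using isCont_tendsto_compose[OF _ tendsto_Pair[OF assms]] by fastforce
qed

lemma mem_orbitI: "q = F t p \<Longrightarrow> q \<in> orbit F p"
  by (auto simp: orbit_def)

lemma mem_orbitE:
  assumes "q \<in> orbit F p" obtains t where "q = F t p"
  using assms by (auto simp: orbit_def)

lemma flow_in_orbit [simp]: "F t q \<in> orbit F q"
  by (rule mem_orbitI) simp

lemma orbit_self [simp]: "q \<in> orbit F q"
  by (rule mem_orbitI[of _ 0]) simp

lemma orbit_flow [simp]: "orbit F (F t q) = orbit F q"
proof -
  have "F s q = F (s - t) (F t q)" for s by simp
  then have "F s q \<in> orbit F (F t q)" for s by (rule mem_orbitI)
  then show ?thesis by (auto elim!: mem_orbitE)
qed

lemma mem_orbit_iff: "p \<in> orbit F q \<longleftrightarrow> orbit F p = orbit F q"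
proof
  assume "p \<in> orbit F q"
  then obtain t where "p = F t q" by (rule mem_orbitE)
  then show "orbit F p = orbit F q" by simp
next
  assume "orbit F p = orbit F q"
  then show "p \<in> orbit F q" using orbit_self[of p] by simp
qed

lemma orbit_eqE:
  assumes "orbit F p = orbit F q" obtains t where "q = F t p"
proof -
  have "q \<in> orbit F p" using assms by simp
  then show ?thesis using that by (rule mem_orbitE)
qed

lemma connected_orbit: "connected (orbit F q)"
proof -
  have "orbit F q = range (\<lambda>t. F t q)" by (auto simp: orbit_def)
  moreover have "connected (range (\<lambda>t. F t q))"
    by (intro connected_continuous_image continuous_intros) auto
  ultimately show ?thesis by simp
qed

lemma flow_box:
  obtains v :: plane and U \<phi> \<psi> where "v \<noteq> 0" "open U" "p \<in> U" "homeomorphism U UNIV \<phi> \<psi>"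
    "\<And>q. q \<in> U \<Longrightarrow> \<phi> ` (orbit F q \<inter> U) = range (\<lambda>t. \<phi> q + t *\<^sub>R v)"
proof -
  obtain v U \<phi> \<psi> where *: "v \<noteq> 0" "open U" "p \<in> U" "homeomorphism U UNIV \<phi> \<psi>"
    "\<forall>q\<in>U. \<phi> ` (orbit F q \<inter> U) = orbit (constant_field_flow v) (\<phi> q)"
    using regular unfolding regular_flow_def by blast
  have "orbit (constant_field_flow v) x = range (\<lambda>t. x + t *\<^sub>R v)" for x
    by (auto simp: orbit_def constant_field_flow_def)
  then show ?thesis using that[OF *(1-4)] *(5) by simp
qed

text \<open>In a flow box around a limit point the whole trace of the orbit corresponds to one full
  line of the constant flow. A line is closed, so the limit point already belongs to the
  trace.\<close>

lemma closed_orbit: "closed (orbit F q)"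
proof -
  have "p \<in> orbit F q" if p: "p \<in> closure (orbit F q)" for p
  proof -
    obtain v :: plane and U \<phi> \<psi> where box: "v \<noteq> 0" "open U" "p \<in> U" and hom: "homeomorphism U UNIV \<phi> \<psi>"
      and line: "\<And>q. q \<in> U \<Longrightarrow> \<phi> ` (orbit F q \<inter> U) = range (\<lambda>t. \<phi> q + t *\<^sub>R v)"
      by (rule flow_box[of p]) (rule that)
    obtain r where r: "r \<in> orbit F q" "r \<in> U"
      using p box by (meson closure_iff_nhds_not_empty disjoint_iff order_refl)
    have rq: "orbit F r = orbit F q" using r by (simp add: mem_orbit_iff)
    have eq: "\<phi> ` (orbit F q \<inter> U) = range (\<lambda>t. \<phi> r + t *\<^sub>R v)"
      using line[OF r(2)] rq by simp
    have "closed (range (\<lambda>t. \<phi> r + t *\<^sub>R v))"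
    proof -
      have "range (\<lambda>t. \<phi> r + t *\<^sub>R v) = (+) (\<phi> r) ` span {v}"
        by (auto simp: span_singleton)
      then show ?thesis using closed_translation[OF closed_span] by metis
    qed
    moreover have "\<phi> p \<in> closure (\<phi> ` (orbit F q \<inter> U))"
    proof -
      have "p \<in> closure (orbit F q \<inter> U)"
        using p box open_Int_closure_subset by (metis IntI inf_commute subsetD)
      then obtain s where s: "\<And>n. s n \<in> orbit F q \<inter> U" "s \<longlonglongrightarrow> p"
        using closure_sequential by metis
      have "(\<lambda>n. \<phi> (s n)) \<longlonglongrightarrow> \<phi> p"
        using hom s box by (intro continuous_on_tendsto_compose[of U \<phi>]) (auto simp: homeomorphism_def)
      then show ?thesis using s(1) by (intro closure_sequential[THEN iffD2] exI conjI) (auto intro: imageI)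
    qed
    ultimately have "\<phi> p \<in> \<phi> ` (orbit F q \<inter> U)" using eq by simp
    then obtain p' where p': "p' \<in> orbit F q" "p' \<in> U" "\<phi> p = \<phi> p'" by blast
    then have "p = p'" using homeomorphism_apply1[OF hom] box(3) by metis
    then show ?thesis using p' by simp
  qed
  then show ?thesis by (meson closure_subset_eq subsetI)
qed

lemma not_fixed: "\<exists>t. F t x \<noteq> x"
proof (rule ccontr)
  assume "\<nexists>t. F t x \<noteq> x"
  then have "orbit F x = {x}" by (auto simp: orbit_def)
  moreover obtain v :: plane and U \<phi> \<psi> where "v \<noteq> 0" "x \<in> U"
      and line: "\<And>q. q \<in> U \<Longrightarrow> \<phi> ` (orbit F q \<inter> U) = range (\<lambda>t. \<phi> q + t *\<^sub>R v)"
    by (rule flow_box[of x]) (rule that)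
  ultimately have "{\<phi> x} = range (\<lambda>t. \<phi> x + t *\<^sub>R v)" using line[of x] by simp
  then have "\<phi> x + 1 *\<^sub>R v \<in> {\<phi> x}" by blast
  then show False using \<open>v \<noteq> 0\<close> by simp
qed

section \<open>Periods and their limits\<close>

lemma flow_multiple: "F e x = x \<Longrightarrow> F (of_int k * e) x = x"
proof -
  assume *: "F e x = x"
  have nat: "F (of_nat n * e) x = x" for n
  proof (induction n)
    case (Suc n)
    have "F (of_nat (Suc n) * e) x = F e (F (of_nat n * e) x)" by (simp add: algebra_simps)
    then show ?case using Suc * by simp
  qed simp
  show ?thesis
  proof (cases "k \<ge> 0")
    case True
    then show ?thesis using nat[of "nat k"] by simp
  next
    case False
    then have "F (- (of_int k * e)) x = x" using nat[of "nat (- k)"] by simp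
    then show ?thesis by (metis flow_add flow_zero add.right_inverse)
  qed
qed

text \<open>Any time \<open>t\<close> lies within \<open>e n\<close> of a multiple of the period
  \<open>e n\<close>, and that multiple fixes \<open>x n\<close>. This excludes arbitrarily small
  periods of one point and also closes the argument by Brouwer's theorem below.\<close>

lemma periodic_limit_fixed:
  assumes "x \<longlonglongrightarrow> l" "e \<longlonglongrightarrow> 0" "\<And>n. e n > 0" "\<And>n. F (e n) (x n) = x n"
  shows "F t l = l"
proof -
  define s where "s n = of_int \<lfloor>t / e n\<rfloor> * e n" for n
  have bound: "\<bar>s n - t\<bar> \<le> e n" for n
  proof -
    have "of_int \<lfloor>t / e n\<rfloor> * e n \<le> t"
      using assms(3)[of n] by (simp add: mult_imp_le_div_pos floor_le_iff pos_le_divide_eq[symmetric])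
    moreover have "t < (of_int \<lfloor>t / e n\<rfloor> + 1) * e n"
      using assms(3)[of n] by (simp add: pos_divide_less_eq[symmetric])
    ultimately show ?thesis unfolding s_def by (simp add: algebra_simps)
  qed
  have "(\<lambda>n. s n - t) \<longlonglongrightarrow> 0"
    by (rule Lim_null_comparison[OF _ assms(2)]) (simp add: bound)
  then have "s \<longlonglongrightarrow> t" using LIM_zero_iff by blast
  then have "(\<lambda>n. F (s n) (x n)) \<longlonglongrightarrow> F t l" using assms(1) by (intro tendsto_intros)
  moreover have "F (s n) (x n) = x n" for n
    unfolding s_def by (intro flow_multiple assms)
  ultimately show ?thesis using assms(1) LIMSEQ_unique by auto
qed

text \<open>The infimum of the positive periods is a period by continuity, and it is not
  \<open>0\<close>, since arbitrarily small periods would make \<open>x\<close> a fixed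
  point.\<close>

lemma minimal_period:
  assumes "F t x = x" "t > 0"
  obtains T where "T > 0" "F T x = x" "\<And>s. 0 < s \<Longrightarrow> s < T \<Longrightarrow> F s x \<noteq> x"
proof -
  define P where "P = {t. t > 0 \<and> F t x = x}"
  have ne: "P \<noteq> {}" "bdd_below P" using assms by (auto simp: P_def intro!: bdd_belowI[of _ 0])
  define T where "T = Inf P"
  have "T \<in> closure P" unfolding T_def using closure_contains_Inf ne by blast
  then obtain e where e: "\<And>n. e n \<in> P" "e \<longlonglongrightarrow> T" using closure_sequential by metis
  have "T \<ge> 0" unfolding T_def using ne by (intro cInf_greatest) (auto simp: P_def)
  moreover have "T \<noteq> 0"
  proof
    assume "T = 0"
    then have "F t x = x" for t
      using e by (intro periodic_limit_fixed[of "\<lambda>_. x" x e t]) (auto simp: P_def)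
    then show False using not_fixed by blast
  qed
  moreover have "F T x = x"
  proof -
    have "(\<lambda>n. F (e n) x) \<longlonglongrightarrow> F T x" using e by (intro tendsto_intros)
    moreover have "(\<lambda>n. F (e n) x) = (\<lambda>_. x)" using e by (auto simp: P_def)
    ultimately show ?thesis by (simp add: LIMSEQ_const_iff)
  qed
  moreover have "F s x \<noteq> x" if "0 < s" "s < T" for s
    using cInf_lower[of s P] that ne unfolding T_def P_def by force
  ultimately show ?thesis using that[of T] by simp
qed

text \<open>The identity of a periodic orbit \<open>C\<close>, a circle, extends to a retraction onto \<open>C\<close> of the
  plane minus finitely many points inside \<open>C\<close>. So the plane retracts onto the flow-invariant set
  \<open>C \<union> inside C\<close>, and by Brouwer's theorem each \<open>F t\<close> has a fixed point there.\<close>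

lemma no_periodic_pos:
  assumes "T0 > 0" shows "F T0 p \<noteq> p"
proof
  assume "F T0 p = p"
  then obtain T where T: "T > 0" "F T p = p" and minT: "\<And>s. 0 < s \<Longrightarrow> s < T \<Longrightarrow> F s p \<noteq> p"
    using minimal_period assms by blast
  define \<gamma> where "\<gamma> s = F (s * T) p" for s
  define C where "C = path_image \<gamma>"
  have loop: "pathfinish \<gamma> = pathstart \<gamma>" by (simp add: \<gamma>_def pathfinish_def pathstart_def T)
  have "simple_path \<gamma>"
    unfolding simple_path_def loop_free_def
  proof (intro conjI ballI impI)
    show "path \<gamma>" unfolding path_def \<gamma>_def by (intro continuous_intros)
    have *: "x = y \<or> x = 0 \<and> y = 1" if "0 \<le> x" "x \<le> y" "y \<le> 1" "\<gamma> x = \<gamma> y" for x y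
    proof (rule ccontr)
      assume "\<not> (x = y \<or> x = 0 \<and> y = 1)"
      then have s: "0 < (y - x) * T" "(y - x) * T < T" using T that by auto
      have "F ((y - x) * T) p = F (- (x * T)) (\<gamma> y)" by (simp add: \<gamma>_def algebra_simps)
      also have "\<dots> = F (- (x * T)) (\<gamma> x)" using that(4) by (rule arg_cong[OF sym])
      also have "\<dots> = p" by (simp add: \<gamma>_def)
      finally show False using minT s by blast
    qed
    fix x y :: real assume "x \<in> {0..1}" "y \<in> {0..1}" "\<gamma> x = \<gamma> y"
    then have "x \<le> y \<Longrightarrow> x = y \<or> x = 0 \<and> y = 1" "y \<le> x \<Longrightarrow> y = x \<or> y = 0 \<and> x = 1"
      by (intro *; simp)+
    then show "x = y \<or> x = 0 \<and> y = 1 \<or> x = 1 \<and> y = 0" by linarith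
  qed
  then have "C homeomorphic sphere (0::complex) 1"
    unfolding C_def by (rule homeomorphic_simple_path_image_circle[OF _ loop]) simp
  then obtain h k where hk: "homeomorphism C (sphere (0::complex) 1) h k"
    unfolding homeomorphic_def by blast
  have "compact C" unfolding C_def using \<open>simple_path \<gamma>\<close> by (simp add: compact_simple_path_image)
  have CF: "C = orbit F p"
  proof
    show "C \<subseteq> orbit F p" by (auto simp: C_def path_image_def \<gamma>_def)
    show "orbit F p \<subseteq> C"
    proof
      fix q assume "q \<in> orbit F p"
      then obtain t where q: "q = F t p" by (auto simp: orbit_def)
      define s where "s = frac (t / T)"
      have "F (s * T) p = F t (F (of_int (- \<lfloor>t / T\<rfloor>) * T) p)"
        using T by (simp add: s_def frac_def algebra_simps)
      also have "\<dots> = q" using q T flow_multiple[of T p "- \<lfloor>t / T\<rfloor>"] by simp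
      finally have "q = \<gamma> s" by (simp add: \<gamma>_def)
      moreover have "s \<in> {0..1}" by (auto simp: s_def frac_lt_1 less_imp_le)
      ultimately show "q \<in> C" by (auto simp: C_def path_image_def)
    qed
  qed
  define D where "D = C \<union> inside C"
  have "compact D"
  proof -
    have "closed C" using \<open>compact C\<close> compact_imp_closed by blast
    have "D = - outside C" by (simp add: D_def union_with_inside)
    then have "closed D" using open_outside[OF \<open>closed C\<close>] by auto
    moreover have "bounded D" unfolding D_def
      using \<open>compact C\<close> bounded_inside compact_imp_bounded by (metis bounded_Un)
    ultimately show ?thesis using compact_eq_bounded_closed by blast
  qed
  \<comment> \<open>An orbit that misses \<open>C\<close> is connected in the complement of
    \<open>C\<close>, so it stays in the component in which it starts.\<close>
  have inv: "F t x \<in> D" if "x \<in> D" for t x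
  proof (cases "x \<in> C")
    case True
    then show ?thesis by (metis CF D_def UnI1 flow_in_orbit orbit_flow mem_orbit_iff)
  next
    case False
    then have x: "x \<in> inside C" using that by (auto simp: D_def)
    have "orbit F x \<inter> C = {}" using False unfolding CF by (metis disjoint_iff mem_orbit_iff)
    then have "connected_component (- C) x (F t x)"
      unfolding connected_component_def
      by (intro exI[of _ "orbit F x"]) (auto simp: connected_orbit)
    then show ?thesis using inside_same_component x by (auto simp: D_def)
  qed
  obtain K g where K: "K \<subseteq> inside C" "disjnt K C" "continuous_on (- K) g"
      "g \<in> (- K) \<rightarrow> sphere (0::complex) 1" and gh: "\<And>x. x \<in> C \<Longrightarrow> g x = h x"
  proof (rule extend_map_UNIV_to_sphere_cofinite[of 1 C h 0 "inside C"])
    show "c \<inter> inside C \<noteq> {}" if c: "c \<in> components (- C)" "bounded c" for c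
    proof -
      obtain x where x: "x \<in> - C" "c = connected_component_set (- C) x"
        using c by (auto simp: components_def)
      then have "x \<in> inside C" "x \<in> c" using c by (auto simp: inside_def connected_component_refl)
      then show ?thesis by blast
    qed
  qed (use hk \<open>compact C\<close> in \<open>auto simp: homeomorphism_def\<close>)
  \<comment> \<open>The excluded points \<open>K\<close> lie inside \<open>C\<close>, where \<rho>
    is the identity, so \<open>g\<close> is used only where it is continuous. On \<open>C\<close>
    both branches agree because \<open>k\<close> inverts \<open>h\<close>.\<close>
  define \<rho> where "\<rho> x = (if x \<in> D then x else k (g x))" for x
  have kg: "k (g x) \<in> C" if "x \<notin> K" for x
    using K(4) hk that unfolding homeomorphism_def by (metis ComplI PiE image_eqI)
  have \<rho>D: "\<rho> x \<in> D" for x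
    using kg[of x] K(1) unfolding \<rho>_def D_def by auto
  have cont_\<rho>: "continuous_on UNIV \<rho>"
  proof -
    have "continuous_on (D \<union> (C \<union> outside C)) \<rho>"
      unfolding \<rho>_def
    proof (rule continuous_on_cases)
      show "closed D" using \<open>compact D\<close> compact_imp_closed by blast
      show "closed (C \<union> outside C)"
        using open_inside \<open>compact C\<close> compact_imp_closed union_with_outside by (metis closed_Compl)
      show "continuous_on D (\<lambda>x. x)" by (intro continuous_intros)
      show "continuous_on (C \<union> outside C) (\<lambda>x. k (g x))"
      proof (rule continuous_on_compose2[of "sphere 0 1" k _ g])
        show "continuous_on (sphere 0 1) k" using hk by (simp add: homeomorphism_def)
        have "C \<union> outside C \<subseteq> - K"
          using K(1,2) inside_Int_outside[of C] unfolding disjnt_def by blast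
        then show "continuous_on (C \<union> outside C) g" "g ` (C \<union> outside C) \<subseteq> sphere 0 1"
          using K continuous_on_subset by blast+
      qed
      show "\<forall>x. x \<in> D \<and> x \<notin> D \<or> x \<in> C \<union> outside C \<and> x \<in> D \<longrightarrow> x = k (g x)"
      proof (intro allI impI)
        fix x assume "x \<in> D \<and> x \<notin> D \<or> x \<in> C \<union> outside C \<and> x \<in> D"
        then have "x \<in> C" using inside_Int_outside[of C] unfolding D_def by blast
        then show "x = k (g x)" using gh hk by (simp add: homeomorphism_def)
      qed
    qed
    moreover have "D \<union> (C \<union> outside C) = UNIV" using inside_Un_outside[of C] unfolding D_def by blast
    ultimately show ?thesis by simp
  qed
  have fixpt: "\<exists>x\<in>D. F t x = x" for t
  proof -
    obtain R where R: "D \<subseteq> cball 0 R"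
      using bounded_subset_ballD[OF compact_imp_bounded[OF \<open>compact D\<close>], of 0] ball_subset_cball by blast
    have "p \<in> D" by (simp add: D_def CF)
    then have "cball 0 R \<noteq> ({} :: plane set)" using R by blast
    moreover have "continuous_on (cball 0 R) (\<lambda>x. F t (\<rho> x))"
      using cont_\<rho> continuous_on_subset by (intro continuous_intros) blast
    moreover have "(\<lambda>x. F t (\<rho> x)) \<in> cball 0 R \<rightarrow> cball 0 R" using inv \<rho>D R by blast
    ultimately obtain x where "F t (\<rho> x) = x"
      by (rule brouwer[OF compact_cball convex_cball])
    moreover from this have "x \<in> D" using inv \<rho>D by metis
    ultimately show ?thesis by (auto simp: \<rho>_def)
  qed
  \<comment> \<open>Points of period \<open>1 / (n + 1)\<close> accumulate in the compact set
    \<open>D\<close>, and an accumulation point would be at rest.\<close>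
  define e where "e n = 1 / real (Suc n)" for n
  have "\<forall>n. \<exists>x. x \<in> D \<and> F (e n) x = x" using fixpt by blast
  then obtain x where x: "\<And>n. x n \<in> D" "\<And>n. F (e n) (x n) = x n" by metis
  obtain l r where lr: "l \<in> D" "strict_mono (r :: nat \<Rightarrow> nat)" "(x \<circ> r) \<longlonglongrightarrow> l"
    using \<open>compact D\<close> x(1) unfolding compact_def by metis
  have "F t l = l" for t
  proof (rule periodic_limit_fixed[of "x \<circ> r" l "e \<circ> r"])
    have "e \<longlonglongrightarrow> 0" unfolding e_def using LIMSEQ_inverse_real_of_nat by (simp add: inverse_eq_divide)
    then show "(e \<circ> r) \<longlonglongrightarrow> 0" using lr LIMSEQ_subseq_LIMSEQ by blast
  qed (use lr x in \<open>auto simp: e_def\<close>)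
  then show False using not_fixed by blast
qed

lemma no_periodic: "F t p = p \<longleftrightarrow> t = 0"
proof
  assume *: "F t p = p"
  then have "F (- t) p = p" by (metis flow_add flow_zero add.left_inverse)
  then show "t = 0" using * no_periodic_pos[of t p] no_periodic_pos[of "- t" p] by linarith
qed simp

lemma flow_inj: "F s p = F t p \<longleftrightarrow> s = t"
proof
  assume "F s p = F t p"
  then have "F (- t) (F s p) = p" by simp
  then show "s = t" using no_periodic[of "- t + s" p] by simp
qed simp

section \<open>Tubes and the separation property\<close>

text \<open>A topological transversal: meeting every orbit at most once stands in for
  transversality, as the flow is only continuous. The parameter runs through the whole line, so that
  the tube is the image of a plane and invariance of domain applies.\<close>

definition cross_section :: "(real \<Rightarrow> plane) \<Rightarrow> bool" where
  "cross_section \<sigma> \<longleftrightarrow> continuous_on UNIV \<sigma> \<and> (\<forall>x y. orbit F (\<sigma> x) = orbit F (\<sigma> y) \<longrightarrow> x = y)"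

lemma exists_cross_section:
  obtains \<sigma> where "cross_section \<sigma>" "\<sigma> 0 = p"
proof -
  obtain v :: plane and U \<phi> \<psi> where box: "v \<noteq> 0" "open U" "p \<in> U" and hom: "homeomorphism U UNIV \<phi> \<psi>"
    and line: "\<And>q. q \<in> U \<Longrightarrow> \<phi> ` (orbit F q \<inter> U) = range (\<lambda>t. \<phi> q + t *\<^sub>R v)"
    by (rule flow_box[of p]) (rule that)
  \<comment> \<open>The vector \<open>v\<close> turned by a right angle: a line along
    \<open>w\<close> meets each line along \<open>v\<close> once.\<close>
  define w :: plane where "w = vector [- (v $ 2), v $ 1]"
  define \<sigma> where "\<sigma> x = \<psi> (\<phi> p + x *\<^sub>R w)" for x
  have \<sigma>U: "\<sigma> x \<in> U" and \<phi>\<sigma>: "\<phi> (\<sigma> x) = \<phi> p + x *\<^sub>R w" for x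
    using hom by (auto simp: homeomorphism_def \<sigma>_def)
  have "cross_section \<sigma>"
    unfolding cross_section_def
  proof (intro conjI allI impI)
    have "continuous_on UNIV \<psi>" using hom by (simp add: homeomorphism_def)
    then show "continuous_on UNIV \<sigma>"
      unfolding \<sigma>_def by (rule continuous_on_compose2) (auto intro!: continuous_intros)
    fix x y assume eq: "orbit F (\<sigma> x) = orbit F (\<sigma> y)"
    then have "\<phi> (\<sigma> y) \<in> \<phi> ` (orbit F (\<sigma> x) \<inter> U)" using \<sigma>U by auto
    then obtain t where "\<phi> (\<sigma> y) = \<phi> (\<sigma> x) + t *\<^sub>R v" using line[OF \<sigma>U] by auto
    then have "(y - x) *\<^sub>R w = t *\<^sub>R v" by (simp add: \<phi>\<sigma> algebra_simps)
    then have "(y - x) * - v$2 = t * v$1" "(y - x) * v$1 = t * v$2"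
      unfolding w_def by (simp_all add: vec_eq_iff forall_2)
    then have "(y - x) * ((v$1)\<^sup>2 + (v$2)\<^sup>2) = 0" by algebra
    moreover have "(v$1)\<^sup>2 + (v$2)\<^sup>2 \<noteq> 0" using box(1) by (simp add: vec_eq_iff forall_2 sum_power2_eq_zero_iff)
    ultimately show "x = y" by auto
  qed
  moreover have "\<sigma> 0 = p" using homeomorphism_apply1[OF hom] box by (simp add: \<sigma>_def)
  ultimately show ?thesis using that by blast
qed

definition tube :: "(real \<Rightarrow> plane) \<Rightarrow> plane set" where
  "tube \<sigma> = range (\<lambda>(x, t). F t (\<sigma> x))"

text \<open>The coordinate \<open>x\<close> names the orbit, \<open>t\<close> is the time elapsed
  since the section. Outside the tube \<open>inv\<close> returns an arbitrary value, so the
  coordinates carry information only on the tube.\<close>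

definition xcoord :: "(real \<Rightarrow> plane) \<Rightarrow> plane \<Rightarrow> real" where
  "xcoord \<sigma> p = fst (inv (\<lambda>(x, t). F t (\<sigma> x)) p)"

definition tcoord :: "(real \<Rightarrow> plane) \<Rightarrow> plane \<Rightarrow> real" where
  "tcoord \<sigma> p = snd (inv (\<lambda>(x, t). F t (\<sigma> x)) p)"

lemma tubeI [simp]: "F t (\<sigma> x) \<in> tube \<sigma>" "\<sigma> x \<in> tube \<sigma>"
  unfolding tube_def using rangeI[of "\<lambda>(x, t). F t (\<sigma> x)" "(x, t)"]
    rangeI[of "\<lambda>(x, t). F t (\<sigma> x)" "(x, 0)"] by simp_all

section \<open>Tubes as open charts\<close>

lemma mem_tube_iff: "p \<in> tube \<sigma> \<longleftrightarrow> (\<exists>x. orbit F p = orbit F (\<sigma> x))"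
proof
  assume "p \<in> tube \<sigma>"
  then obtain x t where "p = F t (\<sigma> x)" by (auto simp: tube_def)
  then show "\<exists>x. orbit F p = orbit F (\<sigma> x)" by auto
next
  assume "\<exists>x. orbit F p = orbit F (\<sigma> x)"
  then obtain x t where "p = F t (\<sigma> x)" by (metis orbit_eqE)
  then show "p \<in> tube \<sigma>" by simp
qed

lemma flow_mem_tube [simp]: "F t p \<in> tube \<sigma> \<longleftrightarrow> p \<in> tube \<sigma>"
  by (simp add: mem_tube_iff)

lemma orbit_mem_tube: "q \<in> orbit F p \<Longrightarrow> q \<in> tube \<sigma> \<longleftrightarrow> p \<in> tube \<sigma>"
  by (simp add: mem_tube_iff mem_orbit_iff)

context
  fixes \<sigma> assumes cs: "cross_section \<sigma>"
begin

lemma continuous_section [continuous_intros]: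
  "continuous_on S f \<Longrightarrow> continuous_on S (\<lambda>x. \<sigma> (f x))"
  using cs continuous_on_compose2[of UNIV \<sigma> S f] by (auto simp: cross_section_def)

lemma tendsto_section:
  assumes "(f \<longlongrightarrow> x) G" shows "((\<lambda>n. \<sigma> (f n)) \<longlongrightarrow> \<sigma> x) G"
proof -
  have "isCont \<sigma> x" using cs by (simp add: cross_section_def continuous_on_eq_continuous_at)
  then show ?thesis using assms isCont_tendsto_compose by blast
qed

text \<open>The section property gives equal parameters; equality of the times is where the absence
  of periodic orbits enters.\<close>

lemma inj_tube: "inj (\<lambda>(x, t). F t (\<sigma> x))"
proof (rule injI, clarify)
  fix x t y s assume eq: "F t (\<sigma> x) = F s (\<sigma> y)"
  then have "orbit F (\<sigma> x) = orbit F (\<sigma> y)" by (metis orbit_flow)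
  then have "x = y" using cs by (simp add: cross_section_def)
  then show "x = y \<and> t = s" using eq flow_inj by blast
qed

lemma coord_flow [simp]: "xcoord \<sigma> (F t (\<sigma> x)) = x" "tcoord \<sigma> (F t (\<sigma> x)) = t"
  using inv_f_f[OF inj_tube, of "(x, t)"] by (simp_all add: xcoord_def tcoord_def)

lemma coord_section [simp]: "xcoord \<sigma> (\<sigma> x) = x" "tcoord \<sigma> (\<sigma> x) = 0"
  using coord_flow[of 0 x] by simp_all

lemma tube_cases:
  assumes "p \<in> tube \<sigma>" obtains "p = F (tcoord \<sigma> p) (\<sigma> (xcoord \<sigma> p))"
proof -
  obtain x t where "p = F t (\<sigma> x)" using assms by (auto simp: tube_def)
  then show ?thesis using that by simp
qed

lemma orbit_xcoord: "p \<in> tube \<sigma> \<Longrightarrow> orbit F (\<sigma> (xcoord \<sigma> p)) = orbit F p"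
  by (metis tube_cases orbit_flow)

lemma coord_flow_add [simp]:
  assumes "p \<in> tube \<sigma>"
  shows "xcoord \<sigma> (F s p) = xcoord \<sigma> p" "tcoord \<sigma> (F s p) = s + tcoord \<sigma> p"
proof -
  obtain x t where "p = F t (\<sigma> x)" using assms by (auto simp: tube_def)
  then show "xcoord \<sigma> (F s p) = xcoord \<sigma> p" "tcoord \<sigma> (F s p) = s + tcoord \<sigma> p" by simp_all
qed

lemma xcoord_orbit: "p \<in> tube \<sigma> \<Longrightarrow> orbit F p = orbit F q \<Longrightarrow> xcoord \<sigma> q = xcoord \<sigma> p"
  by (metis coord_flow_add(1) orbit_eqE)

lemma continuous_chart: "continuous_on UNIV (\<lambda>(x, t). F t (\<sigma> x))"
  unfolding case_prod_beta by (intro continuous_intros)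

lemma open_tube: "open (tube \<sigma>)"
  unfolding tube_def
  by (rule invariance_of_domain_gen) (use inj_tube continuous_chart in auto)

lemma continuous_coords:
  "continuous_on (tube \<sigma>) (xcoord \<sigma>)" "continuous_on (tube \<sigma>) (tcoord \<sigma>)"
proof -
  have "continuous_on (tube \<sigma>) (inv (\<lambda>(x, t). F t (\<sigma> x)))"
    unfolding tube_def
    by (rule continuous_on_inverse_open) (use inj_tube continuous_chart in auto)
  then show "continuous_on (tube \<sigma>) (xcoord \<sigma>)" "continuous_on (tube \<sigma>) (tcoord \<sigma>)"
    unfolding xcoord_def tcoord_def by (intro continuous_intros; simp)+
qed

lemma tendsto_coords:
  assumes "(f \<longlongrightarrow> p) G" "p \<in> tube \<sigma>"
  shows "((\<lambda>n. xcoord \<sigma> (f n)) \<longlongrightarrow> xcoord \<sigma> p) G" "((\<lambda>n. tcoord \<sigma> (f n)) \<longlongrightarrow> tcoord \<sigma> p) G"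
    "eventually (\<lambda>n. f n \<in> tube \<sigma>) G"
proof -
  have "isCont (xcoord \<sigma>) p" "isCont (tcoord \<sigma>) p"
    using continuous_coords open_tube assms(2) by (auto simp: continuous_on_eq_continuous_at)
  then show "((\<lambda>n. xcoord \<sigma> (f n)) \<longlongrightarrow> xcoord \<sigma> p) G" "((\<lambda>n. tcoord \<sigma> (f n)) \<longlongrightarrow> tcoord \<sigma> p) G"
    using assms(1) isCont_tendsto_compose by blast+
  show "eventually (\<lambda>n. f n \<in> tube \<sigma>) G"
    using assms open_tube topological_tendstoD by blast
qed

lemma connected_tube: "connected (tube \<sigma>)"
  unfolding tube_def by (intro connected_continuous_image continuous_chart) auto

text \<open>A circle-valued map that winds once around on crossing a thin closed neighbourhood \<open>N\<close> of
  the orbit, and is \<open>1\<close> outside \<open>N\<close>, lifts to the line; the lift takes different integer values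
  on the two sides of the orbit.\<close>

lemma orbit_section_separates:
  assumes S: "connected S" "S \<inter> orbit F (\<sigma> a) = {}"
    and p: "p \<in> S" "p \<in> tube \<sigma>" "xcoord \<sigma> p < a" and q: "q \<in> S" "q \<in> tube \<sigma>" "a < xcoord \<sigma> q"
  shows False
proof -
  let ?X = "xcoord \<sigma>" and ?T = "tcoord \<sigma>" and ?O = "orbit F (\<sigma> a)"
  \<comment> \<open>On the tube this vanishes exactly on the central orbit. The weight makes the
    strip \<open>N\<close> thinner as the time grows, so that \<open>N\<close> is closed in the
    plane and not only in the tube.\<close>
  define d where "d z = (1 + \<bar>?T z\<bar>) * dist z (F (?T z) (\<sigma> a))" for z
  have d0: "d z \<ge> 0" for z by (simp add: d_def)
  \<comment> \<open>The sign tells the side, the absolute value is \<open>|X - a| + d\<close>. The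
    branches agree at \<open>?X z = a\<close>, because \<open>d\<close> vanishes there.\<close>
  define u where "u z = (if ?X z \<le> a then ?X z - a - d z else ?X z - a + d z)" for z
  define v where "v z = max (-1) (min 1 (u z))" for z
  define c where "c z = (if z \<in> tube \<sigma> then exp (\<i> * of_real (pi * (1 + v z))) else 1)" for z
  define N where "N = {z \<in> tube \<sigma>. \<bar>u z\<bar> \<le> 1}"
  have cont_d: "continuous_on (tube \<sigma>) d"
    unfolding d_def by (intro continuous_intros continuous_coords)
  have cont_u: "continuous_on (tube \<sigma>) u"
    unfolding u_def
  proof (rule continuous_on_cases_le)
    show "?X t - a - d t = ?X t - a + d t" if "t \<in> tube \<sigma>" "?X t = a" for t
      using that by (metis d_def dist_self mult_zero_right tube_cases add.right_neutral diff_zero)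
  qed (auto intro!: continuous_intros continuous_on_subset[OF cont_d] continuous_on_subset[OF continuous_coords(1)] continuous_coords)
  have cont_v: "continuous_on (tube \<sigma>) v"
    unfolding v_def by (intro continuous_intros cont_u)
  have "closed N"
    unfolding closed_sequential_limits
  proof (intro allI impI)
    fix f l assume f: "(\<forall>n. f n \<in> N) \<and> f \<longlonglongrightarrow> l"
    have ft: "f n \<in> tube \<sigma>" and fu: "\<bar>u (f n)\<bar> \<le> 1" for n using f by (auto simp: N_def)
    have "l \<in> tube \<sigma>"
    proof (cases "l \<in> ?O")
      case True
      then show ?thesis by (simp add: orbit_mem_tube)
    next
      case False
      then obtain e where e: "e > 0" "ball l e \<inter> ?O = {}"
        using closed_orbit[of "\<sigma> a"] by (metis Int_commute closed_def disjoint_eq_subset_Compl open_contains_ball ComplI)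
      \<comment> \<open>Terms within \<open>e / 2\<close> of a limit that is \<open>e\<close> away
        from the central orbit satisfy \<open>(1 + |T|) * (e / 2) \<le> d \<le> 1\<close>. This
        bounds their times by \<open>2 / e\<close> and traps them in a compact part of the
        tube.\<close>
      define K where "K = (\<lambda>(x, t). F t (\<sigma> x)) ` ({a - 1..a + 1} \<times> {- (2 / e)..2 / e})"
      have "compact K"
        unfolding K_def by (intro compact_continuous_image continuous_on_subset[OF continuous_chart] compact_Times) auto
      have "eventually (\<lambda>n. dist (f n) l < e / 2) sequentially"
        using f e by (intro tendstoD) auto
      then have "eventually (\<lambda>n. f n \<in> K) sequentially"
      proof eventually_elim
        case (elim n)
        let ?y = "F (?T (f n)) (\<sigma> a)"
        have "?y \<notin> ball l e" using e(2) by (metis disjoint_iff flow_in_orbit)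
        then have "e \<le> dist l ?y" by simp
        also have "\<dots> \<le> dist (f n) l + dist (f n) ?y" by (metis dist_commute dist_triangle)
        finally have "e / 2 \<le> dist (f n) ?y" using elim by linarith
        then have "(1 + \<bar>?T (f n)\<bar>) * (e / 2) \<le> d (f n)" unfolding d_def by (intro mult_left_mono) auto
        moreover have "d (f n) \<le> 1" "\<bar>?X (f n) - a\<bar> \<le> 1"
          using fu[of n] d0[of "f n"] unfolding u_def by (auto split: if_splits)
        ultimately have "(1 + \<bar>?T (f n)\<bar>) * (e / 2) \<le> 1" by linarith
        then have "1 + \<bar>?T (f n)\<bar> \<le> 2 / e" using e(1) by (simp add: field_simps)
        then have "?T (f n) \<in> {- (2 / e)..2 / e}" by auto
        moreover have "?X (f n) \<in> {a - 1..a + 1}" using \<open>\<bar>?X (f n) - a\<bar> \<le> 1\<close> by auto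
        ultimately show "f n \<in> K"
          unfolding K_def using tube_cases[OF ft[of n]]
          by (intro image_eqI[of _ _ "(?X (f n), ?T (f n))"]) auto
      qed
      then have "l \<in> K"
        using Lim_in_closed_set[of K f sequentially l] f \<open>compact K\<close> compact_imp_closed by auto
      then show ?thesis unfolding K_def tube_def by auto
    qed
    moreover have "(\<lambda>n. u (f n)) \<longlonglongrightarrow> u l"
      using f ft cont_u \<open>l \<in> tube \<sigma>\<close> by (intro continuous_on_tendsto_compose[OF cont_u]) auto
    then have "\<bar>u l\<bar> \<le> 1"
      using fu by (intro LIMSEQ_le_const2[OF tendsto_rabs]) auto
    ultimately show "l \<in> N" by (simp add: N_def)
  qed
  have cN: "c z = 1" if "z \<notin> N" for z
  proof (cases "z \<in> tube \<sigma>")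
    case True
    then have "v z = 1 \<or> v z = -1" using that by (auto simp: N_def v_def)
    then have "exp (\<i> * of_real (pi * (1 + v z))) = 1"
      using exp_two_pi_i by (auto simp: mult_ac)
    then show ?thesis by (simp add: c_def)
  qed (simp add: c_def)
  have "continuous_on (tube \<sigma> \<union> - N) c"
  proof (rule continuous_on_open_Un)
    show "open (- N)" using \<open>closed N\<close> by auto
    have "continuous_on (tube \<sigma>) (\<lambda>z. exp (\<i> * of_real (pi * (1 + v z))))"
      by (intro continuous_intros cont_v)
    then show "continuous_on (tube \<sigma>) c"
      by (rule continuous_on_eq) (simp add: c_def)
    show "continuous_on (- N) c"
      by (rule continuous_on_eq[OF continuous_on_const[of _ 1]]) (simp add: cN)
  qed (rule open_tube)
  moreover have "tube \<sigma> \<union> - N = UNIV" by (auto simp: N_def)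
  ultimately have "continuous_on UNIV c" by simp
  moreover have "c z \<noteq> 0" for z by (simp add: c_def)
  ultimately obtain g where g: "continuous_on UNIV g" "\<And>z. c z = exp (g z)"
    using continuous_logarithm_on_contractible[of UNIV c] contractible_UNIV by auto
  define \<theta> where "\<theta> z = Im (g z) / (2 * pi)" for z
  have cont_\<theta>: "continuous_on A \<theta>" for A
    unfolding \<theta>_def by (intro continuous_intros continuous_on_subset[OF g(1)]) auto
  have int1: "\<theta> z \<in> \<int>" if "z \<notin> N" for z
    using cN[OF that] g(2)[of z] exp_eq_1[of "g z"] by (auto simp: \<theta>_def)
  \<comment> \<open>On the tube \<open>c\<close> is the exponential of \<open>g\<close> and of an
    explicit angle, so the two differ by whole turns, a constant number of them because the tube is
    connected.\<close>
  define m where "m z = \<theta> z - (1 + v z) / 2" for z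
  have int2: "m z \<in> \<int>" if "z \<in> tube \<sigma>" for z
  proof -
    have "exp (g z - \<i> * of_real (pi * (1 + v z))) = 1"
      using g(2)[of z] that by (simp add: c_def exp_diff)
    then obtain n :: int where "Im (g z) - pi * (1 + v z) = of_int (2 * n) * pi"
      using exp_eq_1 by auto
    then have "m z = of_int n"
      by (simp add: m_def \<theta>_def field_simps)
    then show ?thesis by simp
  qed
  have const: "f constant_on A" if "connected A" "continuous_on A f" "\<And>z. z \<in> A \<Longrightarrow> f z \<in> \<int>"
    for f :: "plane \<Rightarrow> real" and A
  proof (rule continuous_discrete_range_constant[OF that(1,2)])
    show "\<exists>e>0. \<forall>y. y \<in> A \<and> f y \<noteq> f x \<longrightarrow> e \<le> norm (f y - f x)" if "x \<in> A" for x
    proof (intro exI[of _ 1] conjI allI impI)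
      fix y assume y: "y \<in> A \<and> f y \<noteq> f x"
      then have "f y - f x \<in> \<int>" "f y - f x \<noteq> 0" using that \<open>\<And>z. z \<in> A \<Longrightarrow> f z \<in> \<int>\<close> by auto
      then show "1 \<le> norm (f y - f x)" using Ints_nonzero_abs_ge1[of "f y - f x"] by simp
    qed simp
  qed
  have "m constant_on tube \<sigma>"
    unfolding m_def
    by (rule const[OF connected_tube]) (use int2 in \<open>auto intro!: continuous_intros cont_\<theta> cont_v simp: m_def\<close>)
  then obtain k where k: "\<And>z. z \<in> tube \<sigma> \<Longrightarrow> m z = k" by (auto simp: constant_on_def)
  \<comment> \<open>On the tube but outside \<open>N\<close>, \<theta> is \<open>k\<close> or
    \<open>k + 1\<close> according to the side. Extending these values over \<open>N\<close> gives
    an integer valued function that jumps only across the central orbit.\<close>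
  define w where "w z = (if z \<in> tube \<sigma> then k + (if ?X z > a then 1 else 0) else \<theta> z)" for z
  have uX: "(u z \<le> 0 \<longleftrightarrow> ?X z \<le> a)" for z using d0[of z] by (auto simp: u_def)
  have w\<theta>: "w z = \<theta> z" if "z \<notin> N" for z
  proof (cases "z \<in> tube \<sigma>")
    case True
    then have "v z = (if ?X z > a then 1 else -1)"
      using that uX[of z] by (auto simp: N_def v_def)
    then show ?thesis using k[OF True] True by (auto simp: w_def m_def)
  qed (simp add: w_def)
  have sub: "- ?O \<subseteq> (tube \<sigma> \<inter> ?X -` {..<a} \<union> tube \<sigma> \<inter> ?X -` {a<..}) \<union> - N"
  proof
    fix z assume "z \<in> - ?O"
    then have "z \<in> tube \<sigma> \<Longrightarrow> ?X z \<noteq> a" using orbit_xcoord[of z] by (auto simp: mem_orbit_iff)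
    then show "z \<in> (tube \<sigma> \<inter> ?X -` {..<a} \<union> tube \<sigma> \<inter> ?X -` {a<..}) \<union> - N" by (auto simp: N_def)
  qed
  have op: "open (tube \<sigma> \<inter> ?X -` {..<a})" "open (tube \<sigma> \<inter> ?X -` {a<..})"
    using continuous_open_preimage[OF continuous_coords(1) open_tube] by auto
  have "continuous_on (tube \<sigma> \<inter> ?X -` {..<a}) w"
    by (rule continuous_on_eq[OF continuous_on_const[of _ k]]) (auto simp: w_def)
  moreover have "continuous_on (tube \<sigma> \<inter> ?X -` {a<..}) w"
    by (rule continuous_on_eq[OF continuous_on_const[of _ "k + 1"]]) (auto simp: w_def)
  moreover have "continuous_on (- N) w"
    by (rule continuous_on_eq[OF cont_\<theta>]) (auto simp: w\<theta>)
  ultimately have "continuous_on ((tube \<sigma> \<inter> ?X -` {..<a} \<union> tube \<sigma> \<inter> ?X -` {a<..}) \<union> - N) w"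
    using op \<open>closed N\<close> by (intro continuous_on_open_Un) auto
  then have "continuous_on (- ?O) w" using sub continuous_on_subset by blast
  then have "continuous_on S w" using S(2) continuous_on_subset by blast
  moreover have "w z \<in> \<int>" for z
  proof (cases "z \<in> tube \<sigma>")
    case True
    then show ?thesis using int2[OF True] k[OF True] by (auto simp: w_def)
  next
    case False
    then show ?thesis using int1[of z] by (auto simp: w_def N_def)
  qed
  ultimately have "w constant_on S" using const[OF S(1)] by blast
  then have "w p = w q" using p q by (auto simp: constant_on_def)
  then show False using p q by (simp add: w_def)
qed

text \<open>If the middle orbit missed \<open>S\<close>, then \<open>S\<close> together with the two
  outer orbits would be a connected set with points on both sides of it.\<close>

lemma between_sections_meets:
  assumes S: "connected S" and meet: "orbit F (\<sigma> x) \<inter> S \<noteq> {}" "orbit F (\<sigma> z) \<inter> S \<noteq> {}"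
    and "x \<le> y" "y \<le> z"
  shows "orbit F (\<sigma> y) \<inter> S \<noteq> {}"
proof (rule ccontr)
  assume no: "\<not> ?thesis"
  then have "x \<noteq> y" "y \<noteq> z" using meet by auto
  let ?S = "(orbit F (\<sigma> x) \<union> S) \<union> orbit F (\<sigma> z)"
  have "connected ?S"
    using meet by (intro connected_Un S connected_orbit) auto
  moreover have "?S \<inter> orbit F (\<sigma> y) = {}"
  proof -
    have "orbit F (\<sigma> x) \<noteq> orbit F (\<sigma> y)" "orbit F (\<sigma> z) \<noteq> orbit F (\<sigma> y)"
      using cs \<open>x \<noteq> y\<close> \<open>y \<noteq> z\<close> unfolding cross_section_def by metis+
    then show ?thesis using no by (auto simp: mem_orbit_iff)
  qed
  ultimately show False
    using orbit_section_separates[of ?S y "\<sigma> x" "\<sigma> z"] assms \<open>x \<noteq> y\<close> \<open>y \<noteq> z\<close> by simp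
qed

end

text \<open>Along a subsequence with bounded times the times could be taken convergent, and their
  limit would put \<open>q\<close> on the orbit of \<open>p\<close>.\<close>

lemma unbounded_times:
  assumes "orbit F p \<noteq> orbit F q" "f \<longlonglongrightarrow> p" "(\<lambda>n. F (t n) (f n)) \<longlonglongrightarrow> q"
  shows "eventually (\<lambda>n. M < \<bar>t n\<bar>) sequentially"
proof (rule ccontr)
  assume "\<not> ?thesis"
  then obtain r where r: "strict_mono (r :: nat \<Rightarrow> nat)" "\<And>n. \<bar>t (r n)\<bar> \<le> M"
    using not_eventually_sequentiallyD by (metis not_less)
  have "t (r n) \<in> {-M..M}" for n using r(2)[of n] by auto
  then obtain s l where s: "strict_mono (s :: nat \<Rightarrow> nat)" "((\<lambda>n. t (r n)) \<circ> s) \<longlonglongrightarrow> l"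
    using compact_Icc[of "-M" M] unfolding compact_def by metis
  have rs: "strict_mono (r \<circ> s)" using r s strict_mono_o by blast
  have "(\<lambda>n. F ((t \<circ> (r \<circ> s)) n) ((f \<circ> (r \<circ> s)) n)) \<longlonglongrightarrow> F l p"
    using s(2) LIMSEQ_subseq_LIMSEQ[OF assms(2) rs] by (intro tendsto_intros) (auto simp: o_def)
  moreover have "(\<lambda>n. F ((t \<circ> (r \<circ> s)) n) ((f \<circ> (r \<circ> s)) n)) \<longlonglongrightarrow> q"
    using LIMSEQ_subseq_LIMSEQ[OF assms(3) rs] by (simp add: o_def)
  ultimately have "q = F l p" using LIMSEQ_unique by blast
  then show False using assms(1) by simp
qed

text \<open>The orbits between two orbits that pass near both \<open>p\<close> and \<open>q\<close> do so as well. The time from a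
  cross section at \<open>p\<close> to one at \<open>q\<close> depends continuously on these orbits, and it would change
  sign.\<close>

lemma prolongation_sequences_antisym:
  assumes ne: "orbit F p \<noteq> orbit F q"
    and pq: "f \<longlonglongrightarrow> p" "(\<lambda>n. F (t n) (f n)) \<longlonglongrightarrow> q" "\<And>n. t n \<ge> M"
    and qp: "g \<longlonglongrightarrow> q" "(\<lambda>n. F (s n) (g n)) \<longlonglongrightarrow> p" "\<And>n. s n \<ge> M"
  shows False
proof -
  obtain \<sigma> where \<sigma>: "cross_section \<sigma>" "\<sigma> 0 = p" by (rule exists_cross_section)
  obtain \<rho> where \<rho>: "cross_section \<rho>" "\<rho> 0 = q" by (rule exists_cross_section)
  have pt: "p \<in> tube \<sigma>" and qt: "q \<in> tube \<rho>" using tubeI(2) \<sigma>(2) \<rho>(2) by metis+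
  have c0: "xcoord \<sigma> p = 0" "tcoord \<sigma> p = 0" "xcoord \<rho> q = 0" "tcoord \<rho> q = 0"
    using coord_section[OF \<sigma>(1), of 0] coord_section[OF \<rho>(1), of 0] \<sigma> \<rho> by auto
  have "p \<noteq> q" using ne by auto
  \<comment> \<open>These neighbourhoods prepare the contradiction: a common point of short pieces
    of the two sections would lie in both.\<close>
  then obtain A B where AB: "open A" "open B" "p \<in> A" "q \<in> B" "A \<inter> B = {}"
    using hausdorff[of p q] by blast
  have near: "\<exists>e>0. \<forall>x. \<bar>x\<bar> < e \<longrightarrow> h x \<in> V"
    if "cross_section h" "open V" "h 0 \<in> V" for h and V :: "plane set"
  proof -
    have "isCont h 0" using that(1) by (simp add: cross_section_def continuous_on_eq_continuous_at)
    then have "eventually (\<lambda>x. h x \<in> V) (nhds 0)"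
      using that(2,3) topological_tendstoD[of h "h 0" "at 0" V]
      by (simp add: isCont_def eventually_nhds_conv_at)
    then show ?thesis by (simp add: eventually_nhds_metric dist_real_def)
  qed
  obtain \<alpha> where \<alpha>: "\<alpha> > 0" "\<And>x. \<bar>x\<bar> < \<alpha> \<Longrightarrow> \<sigma> x \<in> A"
    using near[OF \<sigma>(1) AB(1)] \<sigma>(2) AB(3) by blast
  obtain \<beta> where \<beta>: "\<beta> > 0" "\<And>x. \<bar>x\<bar> < \<beta> \<Longrightarrow> \<rho> x \<in> B"
    using near[OF \<rho>(1) AB(2)] \<rho>(2) AB(4) by blast
  have "open (tube \<rho> \<inter> xcoord \<rho> -` {-\<beta><..<\<beta>})"
    using continuous_open_preimage[OF continuous_coords(1)[OF \<rho>(1)] open_tube[OF \<rho>(1)]] by auto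
  moreover have "q \<in> tube \<rho> \<inter> xcoord \<rho> -` {-\<beta><..<\<beta>}" using qt c0 \<beta> by auto
  ultimately obtain r where r: "r > 0" "ball q r \<subseteq> tube \<rho> \<inter> xcoord \<rho> -` {-\<beta><..<\<beta>}"
    using open_contains_ball by blast
  let ?S = "ball q r"
  have conS: "connected ?S" by simp
  note cf = tendsto_coords[OF \<sigma>(1) pq(1) pt] tendsto_coords[OF \<rho>(1) pq(2) qt]
  note cg = tendsto_coords[OF \<sigma>(1) qp(2) pt] tendsto_coords[OF \<rho>(1) qp(1) qt]
  have ev: "eventually (\<lambda>n. \<bar>h n - l\<bar> < e) sequentially" if "h \<longlonglongrightarrow> l" "e > 0" for h and l e :: real
    using tendstoD[OF that] by (simp add: dist_real_def)
  have evS: "eventually (\<lambda>n. h n \<in> ?S) sequentially" if "h \<longlonglongrightarrow> q" for h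
    using that r(1) topological_tendstoD[OF that, of ?S] by simp
  have ne': "orbit F q \<noteq> orbit F p" using ne by simp
  \<comment> \<open>The bound \<open>2 + \<bar>M\<bar>\<close> together with
    \<open>t n \<ge> M\<close> forces \<open>t n > 2\<close>, and likewise \<open>s n > 2\<close>.
    The time coordinates contribute less than \<open>1\<close> each, so the signs of both transit
    times are determined.\<close>
  have "eventually (\<lambda>n. (\<bar>xcoord \<sigma> (f n)\<bar> < \<alpha> \<and> \<bar>tcoord \<sigma> (f n)\<bar> < 1 \<and> f n \<in> tube \<sigma> \<and>
      \<bar>tcoord \<rho> (F (t n) (f n))\<bar> < 1 \<and> 2 + \<bar>M\<bar> < \<bar>t n\<bar> \<and> F (t n) (f n) \<in> ?S) \<and>
      (\<bar>xcoord \<sigma> (F (s n) (g n))\<bar> < \<alpha> \<and> \<bar>tcoord \<sigma> (F (s n) (g n))\<bar> < 1 \<and> F (s n) (g n) \<in> tube \<sigma> \<and>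
      \<bar>tcoord \<rho> (g n)\<bar> < 1 \<and> 2 + \<bar>M\<bar> < \<bar>s n\<bar> \<and> g n \<in> ?S)) sequentially"
    using ev[OF cf(1) \<alpha>(1)] ev[OF cf(2) zero_less_one] cf(3) ev[OF cf(5) zero_less_one]
      unbounded_times[OF ne pq(1,2), of "2 + \<bar>M\<bar>"] evS[OF pq(2)]
      ev[OF cg(1) \<alpha>(1)] ev[OF cg(2) zero_less_one] cg(3) ev[OF cg(5) zero_less_one]
      unbounded_times[OF ne' qp(1,2), of "2 + \<bar>M\<bar>"] evS[OF qp(1)]
    by (simp only: c0 diff_0_right eventually_conj_iff simp_thms)
  then obtain n where n: "\<bar>xcoord \<sigma> (f n)\<bar> < \<alpha>" "\<bar>tcoord \<sigma> (f n)\<bar> < 1" "f n \<in> tube \<sigma>"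
      "\<bar>tcoord \<rho> (F (t n) (f n))\<bar> < 1" "2 + \<bar>M\<bar> < \<bar>t n\<bar>" "F (t n) (f n) \<in> ?S"
      "\<bar>xcoord \<sigma> (F (s n) (g n))\<bar> < \<alpha>" "\<bar>tcoord \<sigma> (F (s n) (g n))\<bar> < 1" "F (s n) (g n) \<in> tube \<sigma>"
      "\<bar>tcoord \<rho> (g n)\<bar> < 1" "2 + \<bar>M\<bar> < \<bar>s n\<bar>" "g n \<in> ?S"
    unfolding eventually_sequentially by blast
  define a where "a = xcoord \<sigma> (f n)"
  define b where "b = xcoord \<sigma> (F (s n) (g n))"
  have fa: "f n = F (tcoord \<sigma> (f n)) (\<sigma> a)"
    using tube_cases[OF \<sigma>(1) n(3)] unfolding a_def by blast
  have gb: "F (s n) (g n) = F (tcoord \<sigma> (F (s n) (g n))) (\<sigma> b)"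
    using tube_cases[OF \<sigma>(1) n(9)] unfolding b_def by blast
  have sa: "\<sigma> a = F (- tcoord \<sigma> (f n) - t n) (F (t n) (f n))" by (subst fa) simp
  have "F (- tcoord \<sigma> (F (s n) (g n)) + s n) (g n) = F (- tcoord \<sigma> (F (s n) (g n))) (F (s n) (g n))" by simp
  also have "\<dots> = \<sigma> b" by (subst gb) simp
  finally have sb: "\<sigma> b = F (- tcoord \<sigma> (F (s n) (g n)) + s n) (g n)" by simp
  have "F (t n) (f n) \<in> tube \<rho>" "g n \<in> tube \<rho>" using n(6,12) r(2) by blast+
  \<comment> \<open>On the orbit through \<open>\<sigma> a\<close> the section at \<open>q\<close>
    is still ahead, on the orbit through \<open>\<sigma> b\<close> it has been passed.\<close>
  then have \<tau>a: "tcoord \<rho> (\<sigma> a) < 0" and \<tau>b: "tcoord \<rho> (\<sigma> b) > 0"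
    unfolding sa sb using n(2,4,5,8,10,11) pq(3)[of n] qp(3)[of n]
    by (simp_all only: coord_flow_add[OF \<rho>(1)])
  have ma: "orbit F (\<sigma> a) \<inter> ?S \<noteq> {}" and mb: "orbit F (\<sigma> b) \<inter> ?S \<noteq> {}"
    using n(6,12) orbit_self unfolding sa sb orbit_flow by (metis disjoint_iff orbit_flow)+
  \<comment> \<open>All intermediate orbits hit the ball around \<open>q\<close>, so the transit
    time is defined and continuous along the whole segment.\<close>
  have meets: "\<exists>y. y \<in> tube \<rho> \<and> \<bar>xcoord \<rho> y\<bar> < \<beta> \<and> orbit F y = orbit F (\<sigma> x)" if "x \<in> closed_segment a b" for x
  proof -
    have "orbit F (\<sigma> x) \<inter> ?S \<noteq> {}"
      using that between_sections_meets[OF \<sigma>(1) conS ma mb, of x]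
        between_sections_meets[OF \<sigma>(1) conS mb ma, of x]
      by (cases "a \<le> b") (simp_all add: closed_segment_eq_real_ivl)
    then obtain y where y: "orbit F y = orbit F (\<sigma> x)" "y \<in> ?S" by (auto simp: mem_orbit_iff)
    then have "y \<in> tube \<rho> \<inter> xcoord \<rho> -` {-\<beta><..<\<beta>}" using r(2) by blast
    then show ?thesis using y(1) by (intro exI[of _ y]) auto
  qed
  have seg: "\<sigma> x \<in> tube \<rho>" "\<bar>xcoord \<rho> (\<sigma> x)\<bar> < \<beta>" if "x \<in> closed_segment a b" for x
    using meets[OF that] xcoord_orbit[OF \<rho>(1)] by (metis mem_tube_iff)+
  have "continuous_on (closed_segment a b) (\<lambda>x. tcoord \<rho> (\<sigma> x))"
    using seg(1) by (intro continuous_on_compose2[OF continuous_coords(2)[OF \<rho>(1)]] continuous_section[OF \<sigma>(1)] continuous_intros) auto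
  then have "connected ((\<lambda>x. tcoord \<rho> (\<sigma> x)) ` closed_segment a b)"
    by (intro connected_continuous_image) auto
  moreover have "tcoord \<rho> (\<sigma> a) \<in> (\<lambda>x. tcoord \<rho> (\<sigma> x)) ` closed_segment a b"
    "tcoord \<rho> (\<sigma> b) \<in> (\<lambda>x. tcoord \<rho> (\<sigma> x)) ` closed_segment a b" by auto
  ultimately have "0 \<in> (\<lambda>x. tcoord \<rho> (\<sigma> x)) ` closed_segment a b"
    using \<tau>a \<tau>b connected_contains_Icc[of _ "tcoord \<rho> (\<sigma> a)" "tcoord \<rho> (\<sigma> b)"] by fastforce
  then obtain x where x: "x \<in> closed_segment a b" "tcoord \<rho> (\<sigma> x) = 0" by auto
  then have "\<sigma> x = \<rho> (xcoord \<rho> (\<sigma> x))"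
    using tube_cases[OF \<rho>(1) seg(1)[OF x(1)]] by (metis flow_zero)
  then have "\<sigma> x \<in> B" using \<beta>(2) seg(2)[OF x(1)] by metis
  moreover have "\<bar>x\<bar> < \<alpha>"
    using x(1) n(1,7) unfolding a_def b_def by (auto simp: closed_segment_eq_real_ivl split: if_splits)
  then have "\<sigma> x \<in> A" using \<alpha>(2) by blast
  ultimately show False using AB by blast
qed

section \<open>Prolongation in terms of convergent orbit segments\<close>

lemma prolongation_sequences:
  assumes "(p, q) \<in> prolongation F"
  obtains f t where "f \<longlonglongrightarrow> p" "(\<lambda>n. F (t n) (f n)) \<longlonglongrightarrow> q" "\<And>n. t n \<ge> 0"
proof -
  obtain h where h: "\<And>n. h n \<in> {(p, q). q \<in> forward_orbit F p}" "h \<longlonglongrightarrow> (p, q)"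
    using assms unfolding prolongation_def closure_sequential by blast
  have "\<forall>n. \<exists>t. t \<ge> 0 \<and> snd (h n) = F t (fst (h n))"
  proof
    fix n
    obtain x y where "h n = (x, y)" by fastforce
    then show "\<exists>t. t \<ge> 0 \<and> snd (h n) = F t (fst (h n))"
      using h(1)[of n] by (auto simp: forward_orbit_def)
  qed
  then obtain t where t: "\<And>n. t n \<ge> 0" "\<And>n. snd (h n) = F (t n) (fst (h n))" by metis
  show ?thesis
    using that[of "\<lambda>n. fst (h n)" t] tendsto_fst[OF h(2)] tendsto_snd[OF h(2)] t by simp
qed

text \<open>The two relations may be witnessed by different points of the same orbits. Moving the
  second family of segments along the flow aligns the endpoints but shifts the times by
  \<open>b - a\<close>; hence the arbitrary lower bound \<open>M\<close> in the statement about
  sequences.\<close>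

lemma orbit_succ_antisym:
  assumes "orbit_succ F s1 s2" "orbit_succ F s2 s1"
  shows False
proof -
  obtain p q where pq: "p \<in> s1" "q \<in> s2" "(p, q) \<in> prolongation F"
    using assms(1) unfolding orbit_succ_def by blast
  obtain p' q' where pq': "p' \<in> s1" "q' \<in> s2" "(q', p') \<in> prolongation F"
    using assms(2) unfolding orbit_succ_def by blast
  have s: "s1 = orbit F p" "s2 = orbit F q" "s1 \<noteq> s2"
    using assms(1) pq(1,2) unfolding orbit_succ_def inseparable_def orbits_def
    by (auto simp: mem_orbit_iff)
  obtain a b where ab: "p' = F a p" "q' = F b q" using pq' s by (auto elim!: mem_orbitE)
  obtain f t where f: "f \<longlonglongrightarrow> p" "(\<lambda>n. F (t n) (f n)) \<longlonglongrightarrow> q" "\<And>n. t n \<ge> 0"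
    using prolongation_sequences[OF pq(3)] by blast
  obtain g u where g: "g \<longlonglongrightarrow> q'" "(\<lambda>n. F (u n) (g n)) \<longlonglongrightarrow> p'" "\<And>n. u n \<ge> 0"
    using prolongation_sequences[OF pq'(3)] by blast
  define M where "M = min 0 (b - a)"
  have g1: "(\<lambda>n. F (- b) (g n)) \<longlonglongrightarrow> q"
    using tendsto_flow[OF tendsto_const g(1), of "- b"] by (simp add: ab)
  have g2: "(\<lambda>n. F (u n + b - a) (F (- b) (g n))) \<longlonglongrightarrow> p"
    using tendsto_flow[OF tendsto_const g(2), of "- a"] by (simp add: ab algebra_simps)
  show False
  proof (rule prolongation_sequences_antisym[OF _ f(1,2) _ g1 g2])
    show "t n \<ge> M" "u n + b - a \<ge> M" for n using f(3)[of n] g(3)[of n] by (auto simp: M_def)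
  qed (use s in simp)
qed

lemma saturated_flow:
  assumes "saturated F N" "p \<in> N"
  shows "F t p \<in> N"
proof -
  obtain C where C: "C \<subseteq> orbits F" "N = \<Union>C" using assms(1) by (auto simp: saturated_def)
  then obtain X where X: "X \<in> C" "p \<in> X" using assms(2) by blast
  then obtain q where "X = orbit F q" using C(1) by (auto simp: orbits_def)
  then have "F t p \<in> X" using X(2) by (simp add: mem_orbit_iff)
  then show ?thesis using X(1) C(2) by blast
qed

text \<open>The segments serve twice: a saturated set containing the start of a segment contains its
  end, which gives inseparability, and the pairs of endpoints converge to a pair in the
  prolongation.\<close>

lemma orbit_succI:
  assumes "orbit F p \<noteq> orbit F q" "f \<longlonglongrightarrow> p" "(\<lambda>n. F (t n) (f n)) \<longlonglongrightarrow> q" "\<And>n. t n \<ge> 0"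
  shows "orbit_succ F (orbit F p) (orbit F q)"
proof -
  have "N1 \<inter> N2 \<noteq> {}" if "saturated_nbhd F (orbit F p) N1" "saturated_nbhd F (orbit F q) N2" for N1 N2
  proof -
    obtain U1 U2 where U: "open U1" "orbit F p \<subseteq> U1" "U1 \<subseteq> N1" "open U2" "orbit F q \<subseteq> U2" "U2 \<subseteq> N2"
      and sat: "saturated F N1"
      using \<open>saturated_nbhd F (orbit F p) N1\<close> \<open>saturated_nbhd F (orbit F q) N2\<close>
      unfolding saturated_nbhd_def by blast
    have "p \<in> U1" "q \<in> U2" using U(2,5) orbit_self by blast+
    then have "eventually (\<lambda>n. f n \<in> U1 \<and> F (t n) (f n) \<in> U2) sequentially"
      using U(1,4) topological_tendstoD[OF assms(2)] topological_tendstoD[OF assms(3)]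
      by (simp add: eventually_conj_iff)
    then obtain n where "f n \<in> U1" "F (t n) (f n) \<in> U2"
      unfolding eventually_sequentially by blast
    then have "F (t n) (f n) \<in> N1 \<inter> N2" using U(3,6) saturated_flow[OF sat] by blast
    then show ?thesis by blast
  qed
  moreover have "(p, q) \<in> prolongation F"
  proof -
    have "(f n, F (t n) (f n)) \<in> {(p, q). q \<in> forward_orbit F p}" for n
      using assms(4)[of n] by (auto simp: forward_orbit_def)
    moreover have "(\<lambda>n. (f n, F (t n) (f n))) \<longlonglongrightarrow> (p, q)"
      using assms(2,3) by (intro tendsto_Pair)
    ultimately show ?thesis
      unfolding prolongation_def closure_sequential by (intro exI[of _ "\<lambda>n. (f n, F (t n) (f n))"]) simp
  qed
  ultimately show ?thesis
    using assms(1) orbit_self unfolding orbit_succ_def inseparable_def orbits_def by blast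
qed

end

section \<open>The space of pairs of corresponding points\<close>

lemma suminf_strict_mono:
  fixes f g :: "nat \<Rightarrow> real"
  assumes "summable f" "summable g" "\<And>n. f n \<le> g n" "f i < g i"
  shows "suminf f < suminf g"
proof -
  have "0 < (\<Sum>n. g n - f n)"
    using assms by (intro suminf_pos2[of _ i] summable_diff) auto
  then show ?thesis using suminf_diff[OF assms(2,1)] by simp
qed

locale orbit_space_iso = A: regular_plane_flow F1 + B: regular_plane_flow F2
  for F1 F2 :: "real \<Rightarrow> plane \<Rightarrow> plane" +
  fixes \<phi> :: "plane set \<Rightarrow> plane set"
  assumes hom: "homeomorphic_map (orbit_space F1) (orbit_space F2) \<phi>"
    and succ_iff: "orbit_succ F1 (orbit F1 x) (orbit F1 y) \<longleftrightarrow>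
      orbit_succ F2 (\<phi> (orbit F1 x)) (\<phi> (orbit F1 y))"
begin

section \<open>Corresponding points under the map of orbit spaces\<close>

definition rel :: "plane \<Rightarrow> plane \<Rightarrow> bool" where
  "rel p q \<longleftrightarrow> \<phi> (orbit F1 p) = orbit F2 q"

lemma rel_flow [simp]: "rel (F1 s p) q \<longleftrightarrow> rel p q" "rel p (F2 s q) \<longleftrightarrow> rel p q"
  by (simp_all add: rel_def)

lemma bij_orbits: "bij_betw \<phi> (orbits F1) (orbits F2)"
  using homeomorphic_imp_surjective_map[OF hom] homeomorphic_imp_injective_map[OF hom]
  by (simp add: bij_betw_def topspace_orbit_space)

lemma rel_total:
  obtains q where "rel p q"
proof -
  have "orbit F1 p \<in> orbits F1" by (simp add: orbits_def)
  then have "\<phi> (orbit F1 p) \<in> orbits F2" using bij_orbits by (auto simp: bij_betw_def)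
  then show ?thesis using that by (auto simp: orbits_def rel_def)
qed

lemma rel_surj:
  obtains p where "rel p q"
proof -
  have "orbit F2 q \<in> orbits F2" by (simp add: orbits_def)
  then obtain s where "s \<in> orbits F1" "\<phi> s = orbit F2 q"
    using bij_orbits unfolding bij_betw_def by (metis imageE)
  then show ?thesis using that by (auto simp: orbits_def rel_def)
qed

lemma rel_fun: "rel p q \<Longrightarrow> rel p q' \<longleftrightarrow> orbit F2 q' = orbit F2 q"
  by (auto simp: rel_def)

lemma rel_inj: "rel p q \<Longrightarrow> rel p' q \<longleftrightarrow> orbit F1 p' = orbit F1 p"
  using bij_orbits unfolding rel_def bij_betw_def inj_on_def orbits_def by (metis rangeI)

lemma rel_mono: "orbit F1 p = orbit F1 p' \<Longrightarrow> orbit F2 q = orbit F2 q' \<Longrightarrow> rel p q \<longleftrightarrow> rel p' q'"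
  by (simp add: rel_def)

text \<open>Continuity of \<phi> in terms of the planes: a saturated open set is the preimage of an
  open set of orbits.\<close>

lemma open_rel_preimage:
  assumes "open V" and sat: "\<And>q t. q \<in> V \<Longrightarrow> F2 t q \<in> V"
  shows "open {p. \<exists>q\<in>V. rel p q}"
proof -
  have mem: "orbit F2 x \<in> orbit F2 ` V \<longleftrightarrow> x \<in> V" for x
  proof
    assume "orbit F2 x \<in> orbit F2 ` V"
    then obtain q where "q \<in> V" "orbit F2 q = orbit F2 x" by auto
    then show "x \<in> V" using sat by (metis B.orbit_eqE)
  qed simp
  have "openin (orbit_space F2) (orbit F2 ` V)"
    using assms(1) by (auto simp: openin_orbit_space mem orbits_def)
  then have "openin (orbit_space F1) {s \<in> topspace (orbit_space F1). \<phi> s \<in> orbit F2 ` V}"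
    using homeomorphic_imp_continuous_map[OF hom] openin_continuous_map_preimage by blast
  then have "open {p. orbit F1 p \<in> {s \<in> orbits F1. \<phi> s \<in> orbit F2 ` V}}"
    by (simp add: openin_orbit_space topspace_orbit_space)
  moreover have "{p. orbit F1 p \<in> {s \<in> orbits F1. \<phi> s \<in> orbit F2 ` V}} = {p. \<exists>q\<in>V. rel p q}"
    by (auto simp: orbits_def rel_def)
  ultimately show ?thesis by simp
qed

text \<open>A common parameter makes the first tube coordinates of corresponding points agree, so
  one \<open>x\<close> and two times describe a pair.\<close>

definition paired_sections :: "(real \<Rightarrow> plane) \<Rightarrow> (real \<Rightarrow> plane) \<Rightarrow> bool" where
  "paired_sections \<sigma> \<rho> \<longleftrightarrow> A.cross_section \<sigma> \<and> B.cross_section \<rho> \<and> (\<forall>x. rel (\<sigma> x) (\<rho> x))"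

text \<open>The sections are first chosen independently. By continuity of \<phi> the orbits matched
  with \<open>\<sigma> x\<close> hit the other section for small \<open>x\<close>, at a unique
  parameter \<open>y x\<close>, and the second section is reparametrised by
  \<open>y\<close>.\<close>

lemma exists_paired_sections:
  assumes "rel p q"
  obtains \<sigma> \<rho> where "paired_sections \<sigma> \<rho>" "\<sigma> 0 = p" "\<rho> 0 = q"
proof -
  obtain \<sigma> where \<sigma>: "A.cross_section \<sigma>" "\<sigma> 0 = p" by (rule A.exists_cross_section)
  obtain \<rho> where \<rho>: "B.cross_section \<rho>" "\<rho> 0 = q" by (rule B.exists_cross_section)
  define V where "V W = B.tube \<rho> \<inter> B.xcoord \<rho> -` W" for W
  define P where "P W = {p. \<exists>q\<in>V W. rel p q}" for W
  have openP: "open (P W)" if "open W" for W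
    unfolding P_def
  proof (rule open_rel_preimage)
    show "open (V W)" unfolding V_def
      using continuous_open_preimage[OF B.continuous_coords(1)[OF \<rho>(1)] B.open_tube[OF \<rho>(1)] that] .
    show "F2 t q \<in> V W" if "q \<in> V W" for t q
      using that by (simp add: V_def B.coord_flow_add[OF \<rho>(1)])
  qed
  have cont\<sigma>: "isCont \<sigma> x" for x
    using \<sigma>(1) by (simp add: A.cross_section_def continuous_on_eq_continuous_at)
  have "q \<in> V UNIV" unfolding V_def using B.tubeI(2)[of \<rho> 0] \<rho>(2) by auto
  then have "\<sigma> 0 \<in> P UNIV" using assms \<sigma>(2) by (auto simp: P_def)
  then have "eventually (\<lambda>x. \<sigma> x \<in> P UNIV) (nhds 0)"
    using cont\<sigma>[of 0] openP[OF open_UNIV] topological_tendstoD[of \<sigma> "\<sigma> 0" "at 0" "P UNIV"]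
    by (simp add: isCont_def eventually_nhds_conv_at)
  then obtain e where e: "e > 0" "\<And>x. \<bar>x\<bar> < e \<Longrightarrow> \<sigma> x \<in> P UNIV"
    by (auto simp: eventually_nhds_metric dist_real_def)
  define y where "y x = (THE y. rel (\<sigma> x) (\<rho> y))" for x
  have y_unique: "y' = y x" if "rel (\<sigma> x) (\<rho> y')" for x y'
    unfolding y_def
  proof (rule sym, rule the_equality)
    show "rel (\<sigma> x) (\<rho> y')" by (rule that)
    fix z assume "rel (\<sigma> x) (\<rho> z)"
    then have "orbit F2 (\<rho> z) = orbit F2 (\<rho> y')" using rel_fun[OF that] by simp
    then show "z = y'" using \<rho>(1) by (simp add: B.cross_section_def)
  qed
  have y: "rel (\<sigma> x) (\<rho> (y x))" if x: "\<bar>x\<bar> < e" for x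
  proof -
    obtain q where q: "q \<in> B.tube \<rho>" "rel (\<sigma> x) q" using e(2)[OF x] by (auto simp: P_def V_def)
    then have "rel (\<sigma> x) (\<rho> (B.xcoord \<rho> q))" using rel_fun B.orbit_xcoord[OF \<rho>(1)] by blast
    then show ?thesis using y_unique by metis
  qed
  have y_P: "\<sigma> x \<in> P W \<longleftrightarrow> y x \<in> W" if x: "\<bar>x\<bar> < e" for x W
  proof
    assume "\<sigma> x \<in> P W"
    then obtain q where q: "q \<in> B.tube \<rho>" "B.xcoord \<rho> q \<in> W" "rel (\<sigma> x) q" by (auto simp: P_def V_def)
    then have "rel (\<sigma> x) (\<rho> (B.xcoord \<rho> q))" using rel_fun B.orbit_xcoord[OF \<rho>(1)] by blast
    then show "y x \<in> W" using y_unique q(2) by metis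
  next
    assume "y x \<in> W"
    then have "\<rho> (y x) \<in> V W" by (simp add: V_def B.coord_section[OF \<rho>(1)])
    then show "\<sigma> x \<in> P W" using y[OF x] by (auto simp: P_def)
  qed
  have cont_y: "isCont y x" if x: "\<bar>x\<bar> < e" for x
    unfolding isCont_def
  proof (rule topological_tendstoI)
    fix W assume W: "open W" "y x \<in> W"
    then have "\<sigma> x \<in> P W" using y_P[OF x] by simp
    then have "eventually (\<lambda>x. \<sigma> x \<in> P W) (at x)"
      using cont\<sigma>[of x] openP[OF W(1)] topological_tendstoD[of \<sigma> "\<sigma> x" "at x" "P W"]
      by (simp add: isCont_def)
    moreover have "eventually (\<lambda>z. z \<in> {-e<..<e}) (at x)"
      using x by (intro eventually_at_in_open') auto
    ultimately show "eventually (\<lambda>x. y x \<in> W) (at x)"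
      by eventually_elim (use y_P in auto)
  qed
  \<comment> \<open>Squeezes the line injectively into the interval on which \<open>y\<close> is
    under control, keeping \<open>0\<close> fixed.\<close>
  define c :: "real \<Rightarrow> real" where "c x = e * (x / (1 + \<bar>x\<bar>))" for x
  have c: "\<bar>c x\<bar> < e" for x
    using e(1) by (simp add: c_def abs_mult pos_divide_less_eq add_pos_nonneg)
  have cont_c: "continuous_on UNIV c" unfolding c_def by (intro continuous_intros) auto
  have inj_c: "x = z" if "c x = c z" for x z
  proof -
    have "x / (1 + \<bar>x\<bar>) = z / (1 + \<bar>z\<bar>)"
      using that e(1) mult_left_cancel[of e] unfolding c_def by blast
    then have eq: "x * (1 + \<bar>z\<bar>) = z * (1 + \<bar>x\<bar>)"
      by (subst (asm) frac_eq_eq) (auto simp: add_nonneg_eq_0_iff)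
    consider "0 \<le> x" "0 \<le> z" | "x < 0" "z < 0" | "0 \<le> x" "z < 0" | "x < 0" "0 \<le> z" by linarith
    then show ?thesis
    proof cases
      case 3
      then have "x * z \<le> 0" by (simp add: mult_nonneg_nonpos)
      then show ?thesis using eq 3 by (simp add: algebra_simps)
    next
      case 4
      then have "z * x \<le> 0" by (simp add: mult_nonneg_nonpos)
      then show ?thesis using eq 4 by (simp add: algebra_simps)
    qed (use eq in \<open>simp_all add: algebra_simps\<close>)
  qed
  have c0: "c 0 = 0" by (simp add: c_def)
  show ?thesis
  proof (rule that[of "\<lambda>x. \<sigma> (c x)" "\<lambda>x. \<rho> (y (c x))"])
    have "continuous_on UNIV (\<lambda>x. \<sigma> (c x))" using A.continuous_section[OF \<sigma>(1) cont_c] .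
    moreover have "continuous_on UNIV (\<lambda>x. y (c x))"
    proof (rule continuous_at_imp_continuous_on, intro ballI)
      fix x
      have "isCont c x" using cont_c by (simp add: continuous_on_eq_continuous_at)
      then show "isCont (\<lambda>x. y (c x)) x" using isCont_o2 cont_y[OF c] by blast
    qed
    then have "continuous_on UNIV (\<lambda>x. \<rho> (y (c x)))" by (rule B.continuous_section[OF \<rho>(1)])
    moreover have "x = z" if "orbit F1 (\<sigma> (c x)) = orbit F1 (\<sigma> (c z))" for x z
      using that inj_c \<sigma>(1) by (simp add: A.cross_section_def)
    moreover have "x = z" if "orbit F2 (\<rho> (y (c x))) = orbit F2 (\<rho> (y (c z)))" for x z
    proof -
      have "rel (\<sigma> (c x)) (\<rho> (y (c z)))" using y[OF c] that rel_fun by metis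
      then have "orbit F1 (\<sigma> (c x)) = orbit F1 (\<sigma> (c z))" using y[OF c] rel_inj by blast
      then show ?thesis using inj_c \<sigma>(1) by (simp add: A.cross_section_def)
    qed
    ultimately show "paired_sections (\<lambda>x. \<sigma> (c x)) (\<lambda>x. \<rho> (y (c x)))"
      unfolding paired_sections_def A.cross_section_def B.cross_section_def using y[OF c] by blast
    show "\<sigma> (c 0) = p" by (simp add: c0 \<sigma>(2))
    have "rel (\<sigma> 0) (\<rho> 0)" using assms \<sigma>(2) \<rho>(2) by simp
    then show "\<rho> (y (c 0)) = q" using y_unique \<rho>(2) by (metis c0)
  qed
qed

lemma paired_tube:
  assumes "paired_sections \<sigma> \<rho>" "rel p q" "p \<in> A.tube \<sigma>"
  shows "q \<in> B.tube \<rho>" "B.xcoord \<rho> q = A.xcoord \<sigma> p"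
proof -
  have cs: "A.cross_section \<sigma>" "B.cross_section \<rho>" and r: "rel (\<sigma> x) (\<rho> x)" for x
    using assms(1) by (auto simp: paired_sections_def)
  have "rel (\<sigma> (A.xcoord \<sigma> p)) q"
    using assms(2) rel_inj A.orbit_xcoord[OF cs(1) assms(3)] by blast
  then have eq: "orbit F2 q = orbit F2 (\<rho> (A.xcoord \<sigma> p))" using r rel_fun by blast
  then show "q \<in> B.tube \<rho>" unfolding B.mem_tube_iff by blast
  show "B.xcoord \<rho> q = A.xcoord \<sigma> p"
    using B.xcoord_orbit[OF cs(2) _ eq[symmetric]] by (simp add: B.coord_section[OF cs(2)])
qed

text \<open>If the limits lay on distinct orbits, then the orbit of \<open>p\<close> would precede that of
  \<open>p'\<close> for the first flow, and follow it for the second.\<close>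

lemma fibre_order_closed:
  assumes "rel p q" "rel p' q'"
    and "f \<longlonglongrightarrow> p" "(\<lambda>n. F1 (t n) (f n)) \<longlonglongrightarrow> p'" "\<And>n. t n \<ge> 0"
    and "g \<longlonglongrightarrow> q" "(\<lambda>n. F2 (- s n) (g n)) \<longlonglongrightarrow> q'" "\<And>n. s n \<ge> 0"
  shows "orbit F1 p' = orbit F1 p"
proof (rule ccontr)
  assume ne: "orbit F1 p' \<noteq> orbit F1 p"
  then have 1: "orbit_succ F1 (orbit F1 p) (orbit F1 p')"
    using A.orbit_succI[of p p' f t] assms by simp
  have "orbit F2 q' \<noteq> orbit F2 q" using ne assms(1,2) rel_inj rel_fun by metis
  moreover have "(\<lambda>n. F2 (s n) (F2 (- s n) (g n))) \<longlonglongrightarrow> q" using assms(6) by simp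
  ultimately have "orbit_succ F2 (orbit F2 q') (orbit F2 q)"
    using B.orbit_succI[of q' q "\<lambda>n. F2 (- s n) (g n)" s] assms(7,8) by blast
  then have "orbit_succ F1 (orbit F1 p') (orbit F1 p)"
    using succ_iff assms(1,2) by (simp add: rel_def)
  with 1 show False using A.orbit_succ_antisym by blast
qed

text \<open>Zero up to \<open>-1\<close>, strictly increasing from there on, bounded by
  \<open>1\<close>. The threshold lies below \<open>0\<close>, so that a bump is positive at the
  base points of its own sections, where both times are \<open>0\<close>.\<close>

definition ramp :: "real \<Rightarrow> real" where
  "ramp t = max 0 (t + 1) / (1 + max 0 (t + 1))"

lemma ramp_bounds: "0 \<le> ramp t" "ramp t \<le> 1"
  by (auto simp: ramp_def max_def)

lemma ramp_pos_iff: "0 < ramp t \<longleftrightarrow> -1 < t"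
  by (cases "-1 < t") (simp_all add: ramp_def)

lemma ramp_eq_0: "t \<le> -1 \<Longrightarrow> ramp t = 0"
  by (simp add: ramp_def max_def)

lemma ramp_strict: "-1 < t \<Longrightarrow> s < t \<Longrightarrow> ramp s < ramp t"
  by (auto simp: ramp_def max_def field_simps)

lemma ramp_mono: "s \<le> t \<Longrightarrow> ramp s \<le> ramp t"
  by (cases "-1 < t") (auto simp: ramp_eq_0 intro: less_imp_le ramp_strict dest: le_neq_trans)

lemma continuous_ramp [continuous_intros]: "continuous_on S g \<Longrightarrow> continuous_on S (\<lambda>x. ramp (g x))"
  unfolding ramp_def by (intro continuous_intros) (auto simp: add_nonneg_eq_0_iff)

lemma tendsto_ramp [tendsto_intros]:
  assumes "(g \<longlongrightarrow> a) G" shows "((\<lambda>x. ramp (g x)) \<longlongrightarrow> ramp a) G"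
proof -
  have "isCont ramp a" using continuous_ramp[of UNIV "\<lambda>x. x"] by (simp add: continuous_on_eq_continuous_at)
  then show ?thesis using assms isCont_tendsto_compose by blast
qed

text \<open>For \<open>e = 1\<close> the function is increasing in \<open>p\<close> and decreasing in \<open>q\<close>, for \<open>e = -1\<close> the
  other way round.\<close>

definition bump :: "real \<Rightarrow> (real \<Rightarrow> plane) \<Rightarrow> (real \<Rightarrow> plane) \<Rightarrow> plane \<times> plane \<Rightarrow> real" where
  "bump e \<sigma> \<rho> = (\<lambda>(p, q). if p \<in> A.tube \<sigma>
     then max 0 (1 - \<bar>A.xcoord \<sigma> p\<bar>) * ramp (e * A.tcoord \<sigma> p) * ramp (- (e * B.tcoord \<rho> q)) else 0)"

section \<open>Bounds, monotonicity and continuity of the bumps\<close>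

lemma bump_bounds: "0 \<le> bump e \<sigma> \<rho> z" "bump e \<sigma> \<rho> z \<le> 1"
proof -
  have *: "0 \<le> max 0 (1 - \<bar>x\<bar>) * ramp s * ramp t" "max 0 (1 - \<bar>x\<bar>) * ramp s * ramp t \<le> 1" for x s t
  proof -
    show "0 \<le> max 0 (1 - \<bar>x\<bar>) * ramp s * ramp t" by (simp add: ramp_bounds)
    have "max 0 (1 - \<bar>x\<bar>) * ramp s \<le> 1 * 1" by (intro mult_mono) (auto simp: ramp_bounds)
    then have "max 0 (1 - \<bar>x\<bar>) * ramp s * ramp t \<le> 1 * 1" by (intro mult_mono) (auto simp: ramp_bounds)
    then show "max 0 (1 - \<bar>x\<bar>) * ramp s * ramp t \<le> 1" by simp
  qed
  show "0 \<le> bump e \<sigma> \<rho> z" "bump e \<sigma> \<rho> z \<le> 1" by (auto simp: bump_def * split: prod.split)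
qed

lemma bump_pos_iff:
  "0 < bump e \<sigma> \<rho> (p, q) \<longleftrightarrow>
    p \<in> A.tube \<sigma> \<and> \<bar>A.xcoord \<sigma> p\<bar> < 1 \<and> -1 < e * A.tcoord \<sigma> p \<and> e * B.tcoord \<rho> q < 1"
  using ramp_bounds(1) ramp_pos_iff[of "e * A.tcoord \<sigma> p"] ramp_pos_iff[of "- (e * B.tcoord \<rho> q)"]
  by (auto simp: bump_def zero_less_mult_iff max_def not_less[symmetric])

text \<open>Where the bump vanishes only weak monotonicity can hold; strictness of the later sum
  comes from one positive term. The last two claims say that the bump dies after a finite time in
  the decreasing direction, which makes the sum tend to \<open>0\<close> there.\<close>

lemma bump_flow:
  assumes "paired_sections \<sigma> \<rho>" "rel p q" "e = 1 \<or> e = -1" "s > 0"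
  shows "bump e \<sigma> \<rho> (p, q) \<le> bump e \<sigma> \<rho> (F1 (e * s) p, q)"
    and "bump e \<sigma> \<rho> (p, q) \<le> bump e \<sigma> \<rho> (p, F2 (- (e * s)) q)"
    and "0 < bump e \<sigma> \<rho> (p, q) \<Longrightarrow> bump e \<sigma> \<rho> (p, q) < bump e \<sigma> \<rho> (F1 (e * s) p, q)"
    and "0 < bump e \<sigma> \<rho> (p, q) \<Longrightarrow> bump e \<sigma> \<rho> (p, q) < bump e \<sigma> \<rho> (p, F2 (- (e * s)) q)"
    and "1 + e * A.tcoord \<sigma> p \<le> s \<Longrightarrow> bump e \<sigma> \<rho> (F1 (- (e * s)) p, q) = 0"
    and "1 - e * B.tcoord \<rho> q \<le> s \<Longrightarrow> bump e \<sigma> \<rho> (p, F2 (e * s) q) = 0"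
proof -
  have cs: "A.cross_section \<sigma>" "B.cross_section \<rho>"
    using assms(1) by (auto simp: paired_sections_def)
  have ee: "e * (e * s) = s" using assms(3) by auto
  have shape: "bump e \<sigma> \<rho> (F1 a p, F2 b q) = max 0 (1 - \<bar>A.xcoord \<sigma> p\<bar>) *
      ramp (e * a + e * A.tcoord \<sigma> p) * ramp (- (e * b) - e * B.tcoord \<rho> q)"
    if "p \<in> A.tube \<sigma>" for a b
    using that paired_tube(1)[OF assms(1,2)]
    by (simp add: bump_def A.coord_flow_add[OF cs(1)] B.coord_flow_add[OF cs(2)] algebra_simps)
  have zero: "bump e \<sigma> \<rho> (F1 a p, F2 b q) = 0" if "p \<notin> A.tube \<sigma>" for a b
    using that by (simp add: bump_def)
  let ?l = "max 0 (1 - \<bar>A.xcoord \<sigma> p\<bar>)" and ?t = "e * A.tcoord \<sigma> p" and ?u = "- (e * B.tcoord \<rho> q)"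
  have z: "bump e \<sigma> \<rho> (p, q) = (if p \<in> A.tube \<sigma> then ?l * ramp ?t * ramp ?u else 0)"
    using shape[of 0 0] zero[of 0 0] by simp
  have z1: "bump e \<sigma> \<rho> (F1 a p, q) = (if p \<in> A.tube \<sigma> then ?l * ramp (e * a + ?t) * ramp ?u else 0)" for a
    using shape[of a 0] zero[of a 0] by simp
  have z2: "bump e \<sigma> \<rho> (p, F2 b q) = (if p \<in> A.tube \<sigma> then ?l * ramp ?t * ramp (- (e * b) + ?u) else 0)" for b
    using shape[of 0 b] zero[of 0 b] by simp
  have l: "?l \<ge> 0" by simp
  note rb = ramp_bounds(1)
  have m1: "ramp ?t \<le> ramp (s + ?t)" and m2: "ramp ?u \<le> ramp (s + ?u)" using assms(4) by (auto intro: ramp_mono)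
  show "bump e \<sigma> \<rho> (p, q) \<le> bump e \<sigma> \<rho> (F1 (e * s) p, q)"
    unfolding z z1 ee using m1 rb[of ?u] l by (simp add: mult_left_mono mult_right_mono)
  show "bump e \<sigma> \<rho> (p, q) \<le> bump e \<sigma> \<rho> (p, F2 (- (e * s)) q)"
    unfolding z z2 using m2 rb[of ?t] l by (simp add: ee mult_left_mono)
  show "1 + ?t \<le> s \<Longrightarrow> bump e \<sigma> \<rho> (F1 (- (e * s)) p, q) = 0"
    unfolding z1 by (simp add: ee ramp_eq_0)
  show "1 - e * B.tcoord \<rho> q \<le> s \<Longrightarrow> bump e \<sigma> \<rho> (p, F2 (e * s) q) = 0"
    unfolding z2 by (simp add: ee ramp_eq_0)
  assume "0 < bump e \<sigma> \<rho> (p, q)"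
  then have pt: "p \<in> A.tube \<sigma>" and pos: "?l > 0" "-1 < ?t" "-1 < ?u"
    unfolding bump_pos_iff by auto
  have rp: "ramp ?t > 0" "ramp ?u > 0" using pos by (simp_all only: ramp_pos_iff)
  have st: "ramp ?t < ramp (s + ?t)" "ramp ?u < ramp (s + ?u)"
    using assms(4) pos by (auto intro!: ramp_strict)
  show "bump e \<sigma> \<rho> (p, q) < bump e \<sigma> \<rho> (F1 (e * s) p, q)"
    unfolding z z1 ee using pt mult_strict_right_mono[OF mult_strict_left_mono[OF st(1) pos(1)] rp(2)] by simp
  show "bump e \<sigma> \<rho> (p, q) < bump e \<sigma> \<rho> (p, F2 (- (e * s)) q)"
    unfolding z z2 using pt mult_strict_left_mono[OF st(2) mult_pos_pos[OF pos(1) rp(1)]] by (simp add: ee)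
qed

text \<open>The pullback of the two orbit projections along \<phi>; its fibre over an orbit is a
  product of two lines.\<close>

definition fibre_product :: "(plane \<times> plane) set" where
  "fibre_product = {(p, q). rel p q}"

text \<open>The danger is a limit \<open>p\<close> outside the tube. Positive bumps near it have
  section parameters in \<open>[-1, 1]\<close>, convergent along a subsequence to some
  \<open>x\<close>. The pairs are comparable with the corners of the quadrants over these
  parameters, so \<open>fibre_order_closed\<close> puts \<open>p\<close> on the orbit of
  \<open>\<sigma> x\<close>, inside the tube.\<close>

lemma continuous_bump:
  assumes ps: "paired_sections \<sigma> \<rho>" and e: "e = 1 \<or> e = -1"
  shows "continuous_on fibre_product (bump e \<sigma> \<rho>)"
  unfolding continuous_on_sequentially
proof (intro allI ballI impI)
  fix h z assume z: "z \<in> fibre_product" and h: "(\<forall>n. h n \<in> fibre_product) \<and> h \<longlonglongrightarrow> z"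
  obtain p q where pq: "z = (p, q)" "rel p q" using z by (auto simp: fibre_product_def)
  have cs: "A.cross_section \<sigma>" "B.cross_section \<rho>" and r: "rel (\<sigma> x) (\<rho> x)" for x
    using ps by (auto simp: paired_sections_def)
  define f where "f n = fst (h n)" for n
  define g where "g n = snd (h n)" for n
  have fg: "h n = (f n, g n)" "rel (f n) (g n)" for n
    using h by (auto simp: f_def g_def fibre_product_def case_prod_beta)
  have lim: "f \<longlonglongrightarrow> p" "g \<longlonglongrightarrow> q"
    using tendsto_fst[OF conjunct2[OF h]] tendsto_snd[OF conjunct2[OF h]] by (simp_all add: f_def[abs_def] g_def[abs_def] pq)
  show "(bump e \<sigma> \<rho> \<circ> h) \<longlonglongrightarrow> bump e \<sigma> \<rho> z"
  proof (cases "p \<in> A.tube \<sigma>")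
    case True
    note tA = A.tendsto_coords[OF cs(1) lim(1) True]
    note tB = B.tendsto_coords[OF cs(2) lim(2) paired_tube(1)[OF ps pq(2) True]]
    have "(\<lambda>n. max 0 (1 - \<bar>A.xcoord \<sigma> (f n)\<bar>) * ramp (e * A.tcoord \<sigma> (f n)) * ramp (- (e * B.tcoord \<rho> (g n))))
       \<longlonglongrightarrow> max 0 (1 - \<bar>A.xcoord \<sigma> p\<bar>) * ramp (e * A.tcoord \<sigma> p) * ramp (- (e * B.tcoord \<rho> q))"
      by (intro tendsto_intros tA tB)
    moreover have "eventually (\<lambda>n. max 0 (1 - \<bar>A.xcoord \<sigma> (f n)\<bar>) * ramp (e * A.tcoord \<sigma> (f n)) *
        ramp (- (e * B.tcoord \<rho> (g n))) = (bump e \<sigma> \<rho> \<circ> h) n) sequentially"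
      using tA(3) by eventually_elim (simp add: bump_def fg)
    moreover have "bump e \<sigma> \<rho> z = max 0 (1 - \<bar>A.xcoord \<sigma> p\<bar>) * ramp (e * A.tcoord \<sigma> p) *
        ramp (- (e * B.tcoord \<rho> q))"
      using True by (simp add: pq bump_def)
    ultimately show ?thesis by (simp only:) (rule Lim_transform_eventually)
  next
    case False
    have "eventually (\<lambda>n. bump e \<sigma> \<rho> (h n) = 0) sequentially"
    proof (rule ccontr)
      assume not0: "\<not> ?thesis"
      obtain k where k: "strict_mono (k :: nat \<Rightarrow> nat)" "\<And>n. bump e \<sigma> \<rho> (h (k n)) \<noteq> 0"
        using not_eventually_sequentiallyD[OF not0] by blast
      let ?X = "\<lambda>n. A.xcoord \<sigma> (f (k n))"
      have pos: "0 < bump e \<sigma> \<rho> (f (k n), g (k n))" for n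
        using k(2)[of n] bump_bounds(1)[of e \<sigma> \<rho> "h (k n)"] by (simp add: fg)
      note pos' = pos[unfolded bump_pos_iff]
      have "?X n \<in> {-1..1}" for n using pos'[of n] by auto
      then obtain x l where x: "strict_mono (l :: nat \<Rightarrow> nat)" "(?X \<circ> l) \<longlonglongrightarrow> x"
        using compact_Icc[of "-1" "1::real"] unfolding compact_def by metis
      define m where "m = k \<circ> l"
      have m: "strict_mono m" using k(1) x(1) by (simp add: m_def strict_mono_o)
      define X where "X n = A.xcoord \<sigma> (f (m n))" for n
      define T where "T n = A.tcoord \<sigma> (f (m n))" for n
      define S where "S n = B.tcoord \<rho> (g (m n))" for n
      have limX: "X \<longlonglongrightarrow> x" using x(2) by (simp add: X_def[abs_def] m_def o_def)
      have TS: "-1 < e * T n" "e * S n < 1" and mt: "f (m n) \<in> A.tube \<sigma>" for n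
        using pos'[of "l n"] by (auto simp: T_def S_def m_def)
      have mt': "g (m n) \<in> B.tube \<rho>" "B.xcoord \<rho> (g (m n)) = X n" for n
        using paired_tube[OF ps fg(2) mt] by (auto simp: X_def)
      have fm: "f (m n) = F1 (T n) (\<sigma> (X n))" for n
        using A.tube_cases[OF cs(1) mt[of n]] unfolding T_def X_def .
      have gm: "g (m n) = F2 (S n) (\<rho> (X n))" for n
        using B.tube_cases[OF cs(2) mt'(1)[of n]] unfolding S_def mt'(2) .
      have lim': "(\<lambda>n. f (m n)) \<longlonglongrightarrow> p" "(\<lambda>n. g (m n)) \<longlonglongrightarrow> q"
        using LIMSEQ_subseq_LIMSEQ[OF _ m] lim by (auto simp: o_def)
      have cont: "(\<lambda>n. F1 a (\<sigma> (X n))) \<longlonglongrightarrow> F1 a (\<sigma> x)" "(\<lambda>n. F2 a (\<rho> (X n))) \<longlonglongrightarrow> F2 a (\<rho> x)" for a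
        by (intro A.tendsto_flow B.tendsto_flow tendsto_const A.tendsto_section[OF cs(1)]
            B.tendsto_section[OF cs(2)] limX)+
      have "orbit F1 p = orbit F1 (\<sigma> x)"
      proof (cases "e = 1")
        case True
        \<comment> \<open>The corner of the quadrant is
          \<open>(F1 (-1) (\<sigma> (X n)), F2 1 (\<rho> (X n)))\<close>, and \<open>T n + 1\<close>
          and \<open>1 - S n\<close> are the times from it to the pair. For \<open>e = -1\<close>
          the corner comes after the pair and the two limits exchange roles.\<close>
        have "orbit F1 p = orbit F1 (F1 (-1) (\<sigma> x))"
        proof (rule fibre_order_closed[OF _ pq(2) cont(1) _ _ cont(2)])
          show "(\<lambda>n. F1 (T n + 1) (F1 (-1) (\<sigma> (X n)))) \<longlonglongrightarrow> p" using lim'(1) by (simp add: fm)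
          show "(\<lambda>n. F2 (- (1 - S n)) (F2 1 (\<rho> (X n)))) \<longlonglongrightarrow> q" using lim'(2) by (simp add: gm)
          show "0 \<le> T n + 1" "0 \<le> 1 - S n" for n using TS[of n] True by auto
        qed (simp add: r)
        then show ?thesis by simp
      next
        case False
        then have e1: "e = -1" using e by simp
        have "orbit F1 (F1 1 (\<sigma> x)) = orbit F1 p"
        proof (rule fibre_order_closed[OF pq(2) _ lim'(1) _ _ lim'(2)])
          show "(\<lambda>n. F1 (1 - T n) (f (m n))) \<longlonglongrightarrow> F1 1 (\<sigma> x)" using cont(1)[of 1] by (simp add: fm)
          show "(\<lambda>n. F2 (- (S n + 1)) (g (m n))) \<longlonglongrightarrow> F2 (-1) (\<rho> x)" using cont(2)[of "-1"] by (simp add: gm)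
          show "0 \<le> 1 - T n" "0 \<le> S n + 1" for n using TS[of n] e1 by auto
        qed (simp add: r)
        then show ?thesis by simp
      qed
      then show False using False by (auto simp: A.mem_tube_iff)
    qed
    then have "(bump e \<sigma> \<rho> \<circ> h) \<longlonglongrightarrow> 0" by (intro tendsto_eventually) simp
    then show ?thesis using False by (simp add: pq bump_def)
  qed
qed

section \<open>The homeomorphism of the plane\<close>

text \<open>Every pair is the base point of sections of its own, so the open sets where the bumps of
  both signs are positive cover the fibre product, and Lindelof's theorem leaves countably
  many.\<close>

lemma exists_countable_sections:
  obtains \<sigma> \<rho> :: "nat \<Rightarrow> real \<Rightarrow> plane" where "\<And>k. paired_sections (\<sigma> k) (\<rho> k)"
    "\<And>p q e. rel p q \<Longrightarrow> e = 1 \<or> e = -1 \<Longrightarrow> \<exists>k. 0 < bump e (\<sigma> k) (\<rho> k) (p, q)"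
proof -
  have "\<forall>z\<in>fibre_product. \<exists>\<sigma> \<rho>. paired_sections \<sigma> \<rho> \<and> \<sigma> 0 = fst z \<and> \<rho> 0 = snd z"
  proof
    fix z assume "z \<in> fibre_product"
    then have "rel (fst z) (snd z)" by (auto simp: fibre_product_def)
    then show "\<exists>\<sigma> \<rho>. paired_sections \<sigma> \<rho> \<and> \<sigma> 0 = fst z \<and> \<rho> 0 = snd z"
      using exists_paired_sections by metis
  qed
  then obtain \<sigma> \<rho> where ps: "\<And>z. z \<in> fibre_product \<Longrightarrow> paired_sections (\<sigma> z) (\<rho> z)"
      and base: "\<And>z. z \<in> fibre_product \<Longrightarrow> \<sigma> z 0 = fst z" "\<And>z. z \<in> fibre_product \<Longrightarrow> \<rho> z 0 = snd z"
    by metis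
  define W where "W z = (fibre_product \<inter> bump 1 (\<sigma> z) (\<rho> z) -` {0<..}) \<inter> (fibre_product \<inter> bump (-1) (\<sigma> z) (\<rho> z) -` {0<..})" for z
  have openW: "openin (top_of_set fibre_product) S" if S: "S \<in> W ` fibre_product" for S
  proof -
    obtain z where z: "z \<in> fibre_product" "S = W z" using S by blast
    show ?thesis
      unfolding z W_def using continuous_bump[OF ps[OF z(1)]]
      by (intro openin_Int continuous_openin_preimage_gen) auto
  qed
  have self: "z \<in> W z" if "z \<in> fibre_product" for z
  proof -
    have cs: "A.cross_section (\<sigma> z)" "B.cross_section (\<rho> z)" using ps[OF that] by (auto simp: paired_sections_def)
    have "0 < bump e (\<sigma> z) (\<rho> z) (\<sigma> z 0, \<rho> z 0)" for e
      unfolding bump_pos_iff by (simp add: A.coord_section[OF cs(1)] B.coord_section[OF cs(2)])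
    then show ?thesis using that by (simp add: W_def base)
  qed
  obtain \<F> where \<F>: "\<F> \<subseteq> W ` fibre_product" "countable \<F>" "\<Union>\<F> = \<Union>(W ` fibre_product)"
    using Lindelof_openin[OF openW] by blast
  then obtain C where C: "countable C" "C \<subseteq> fibre_product" "\<F> = W ` C" by (metis countable_subset_image)
  have cover: "\<exists>c\<in>C. z \<in> W c" if "z \<in> fibre_product" for z
    using self[OF that] that \<F>(3) C(3) by blast
  obtain q where "rel 0 q" by (rule rel_total)
  then have "C \<noteq> {}" using cover[of "(0, q)"] by (auto simp: fibre_product_def)
  show ?thesis
  proof (rule that[of "\<lambda>k. \<sigma> (from_nat_into C k)" "\<lambda>k. \<rho> (from_nat_into C k)"])
    show "paired_sections (\<sigma> (from_nat_into C k)) (\<rho> (from_nat_into C k))" for k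
      using ps from_nat_into[OF \<open>C \<noteq> {}\<close>] C(2) by blast
    fix p q and e :: real assume "rel p q" and e: "e = 1 \<or> e = -1"
    then obtain c where c: "c \<in> C" "(p, q) \<in> W c" using cover[of "(p, q)"] by (auto simp: fibre_product_def)
    obtain k where "from_nat_into C k = c" using from_nat_into_surj[OF C(1) c(1)] by blast
    then show "\<exists>k. 0 < bump e (\<sigma> (from_nat_into C k)) (\<rho> (from_nat_into C k)) (p, q)"
      using c(2) e by (intro exI[of _ k]) (auto simp: W_def)
  qed
qed

text \<open>The sums of the bumps of either sign are positive everywhere. Going backwards in
  \<open>p\<close> or forwards in \<open>q\<close>, \<open>S 1\<close> tends to \<open>0\<close>
  while \<open>S (-1)\<close> grows, and conversely in the other direction, so their difference
  changes sign on every line.\<close>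

lemma exists_order_function:
  obtains K :: "plane \<times> plane \<Rightarrow> real" where "continuous_on fibre_product K"
    "\<And>p q s. rel p q \<Longrightarrow> s > 0 \<Longrightarrow> K (p, q) < K (F1 s p, q)"
    "\<And>p q s. rel p q \<Longrightarrow> s > 0 \<Longrightarrow> K (p, F2 s q) < K (p, q)"
    "\<And>p q. rel p q \<Longrightarrow> \<exists>s. K (F1 s p, q) < 0" "\<And>p q. rel p q \<Longrightarrow> \<exists>s. 0 < K (F1 s p, q)"
    "\<And>p q. rel p q \<Longrightarrow> \<exists>s. K (p, F2 s q) < 0" "\<And>p q. rel p q \<Longrightarrow> \<exists>s. 0 < K (p, F2 s q)"
proof -
  obtain \<sigma> \<rho> :: "nat \<Rightarrow> real \<Rightarrow> plane" where ps: "\<And>k. paired_sections (\<sigma> k) (\<rho> k)"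
    and pos: "\<And>p q e. rel p q \<Longrightarrow> e = 1 \<or> e = -1 \<Longrightarrow> \<exists>k. 0 < bump e (\<sigma> k) (\<rho> k) (p, q)"
    by (rule exists_countable_sections) (rule that)
  define a where "a e k z = (1/2)^k * bump e (\<sigma> k) (\<rho> k) z" for e k z
  define S where "S e z = (\<Sum>k. a e k z)" for e z
  have a: "0 \<le> a e k z" "a e k z \<le> (1/2)^k" for e k z
    unfolding a_def using bump_bounds[of e "\<sigma> k" "\<rho> k" z] by (auto simp: mult_left_le)
  have geo: "summable (\<lambda>k. (1/2)^k :: real)" by (simp add: summable_geometric)
  have summ: "summable (\<lambda>k. a e k z)" for e z
    by (rule summable_comparison_test'[OF geo, of 0]) (use a in auto)
  have cont: "continuous_on fibre_product (S e)" if "e = 1 \<or> e = -1" for e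
  proof -
    have "uniform_limit fibre_product (\<lambda>n z. \<Sum>k<n. a e k z) (\<lambda>z. \<Sum>k. a e k z) sequentially"
      by (rule Weierstrass_m_test[OF _ geo]) (use a in auto)
    moreover have "continuous_on fibre_product (\<lambda>z. \<Sum>k<n. a e k z)" for n
      unfolding a_def by (intro continuous_intros continuous_bump ps that)
    ultimately show ?thesis
      unfolding S_def[abs_def] by (intro uniform_limit_theorem[where F = sequentially]) auto
  qed
  have Spos: "0 < S e (p, q)" if pq: "rel p q" and e: "e = 1 \<or> e = -1" for p q e
  proof -
    obtain k where "0 < bump e (\<sigma> k) (\<rho> k) (p, q)" using pos[OF pq e] by blast
    then show ?thesis
      unfolding S_def using a summ by (intro suminf_pos2[of _ k]) (auto simp: a_def)
  qed
  have S1: "S e (p, q) < S e (F1 (e * s) p, q)" and S2: "S e (p, q) < S e (p, F2 (- (e * s)) q)"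
    if pq: "rel p q" and e: "e = 1 \<or> e = -1" and s: "s > 0" for p q e s
  proof -
    obtain k where k: "0 < bump e (\<sigma> k) (\<rho> k) (p, q)" using pos[OF pq e] by blast
    note bf = bump_flow[OF ps pq e s]
    show "S e (p, q) < S e (F1 (e * s) p, q)"
      unfolding S_def
      by (rule suminf_strict_mono[OF summ summ, of _ _ _ _ k]) (use bf(1) bf(3)[OF k] in \<open>simp_all add: a_def\<close>)
    show "S e (p, q) < S e (p, F2 (- (e * s)) q)"
      unfolding S_def
      by (rule suminf_strict_mono[OF summ summ, of _ _ _ _ k]) (use bf(2) bf(4)[OF k] in \<open>simp_all add: a_def\<close>)
  qed
  \<comment> \<open>Each bump vanishes eventually, but from a time depending on \<open>k\<close>;
    the geometric bound lets the limit pass through the sum.\<close>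
  have lim: "((\<lambda>s. S e (h s)) \<longlongrightarrow> 0) at_top"
    if "\<And>k. eventually (\<lambda>s. bump e (\<sigma> k) (\<rho> k) (h s) = 0) at_top" for e and h :: "real \<Rightarrow> plane \<times> plane"
  proof -
    have "((\<lambda>s. \<Sum>k. a e k (h s)) \<longlongrightarrow> (\<Sum>k. 0)) at_top"
    proof (rule conjunct2[OF conjunct2[OF tannerys_theorem]])
      show "((\<lambda>s. a e k (h s)) \<longlongrightarrow> 0) at_top" for k
        by (rule tendsto_eventually) (use that[of k] in \<open>simp add: a_def\<close>)
      show "eventually (\<lambda>(k, s). norm (a e k (h s)) \<le> (1/2)^k) (at_top \<times>\<^sub>F at_top)"
        using a by (intro always_eventually) auto
    qed (use geo in auto)
    then show ?thesis by (simp add: S_def)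
  qed
  have S3: "((\<lambda>s. S e (F1 (- (e * s)) p, q)) \<longlongrightarrow> 0) at_top"
    and S4: "((\<lambda>s. S e (p, F2 (e * s) q)) \<longlongrightarrow> 0) at_top" if pq: "rel p q" and e: "e = 1 \<or> e = -1" for p q e
  proof -
    show "((\<lambda>s. S e (F1 (- (e * s)) p, q)) \<longlongrightarrow> 0) at_top"
    proof (rule lim)
      fix k
      have "eventually (\<lambda>s. s > 0 \<and> 1 + e * A.tcoord (\<sigma> k) p \<le> s) at_top"
        by (intro eventually_conj eventually_gt_at_top eventually_ge_at_top)
      then show "eventually (\<lambda>s. bump e (\<sigma> k) (\<rho> k) (F1 (- (e * s)) p, q) = 0) at_top"
        by eventually_elim (use bump_flow(5)[OF ps pq e] in blast)
    qed
    show "((\<lambda>s. S e (p, F2 (e * s) q)) \<longlongrightarrow> 0) at_top"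
    proof (rule lim)
      fix k
      have "eventually (\<lambda>s. s > 0 \<and> 1 - e * B.tcoord (\<rho> k) q \<le> s) at_top"
        by (intro eventually_conj eventually_gt_at_top eventually_ge_at_top)
      then show "eventually (\<lambda>s. bump e (\<sigma> k) (\<rho> k) (p, F2 (e * s) q) = 0) at_top"
        by eventually_elim (use bump_flow(6)[OF ps pq e] in blast)
    qed
  qed
  have small: "\<exists>s>0. u s < d" if "(u \<longlongrightarrow> 0) at_top" "d > 0" for u :: "real \<Rightarrow> real" and d
  proof -
    have "eventually (\<lambda>s. s > 0 \<and> u s < d) at_top"
      using order_tendstoD(2)[OF that] by (intro eventually_conj eventually_gt_at_top)
    then show ?thesis unfolding eventually_at_top_linorder by blast
  qed
  define K where "K z = S 1 z - S (-1) z" for z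
  show ?thesis
  proof (rule that[of K])
    show "continuous_on fibre_product K" unfolding K_def[abs_def] by (intro continuous_on_diff cont) auto
    fix p q assume pq: "rel p q"
    show "K (p, q) < K (F1 s p, q)" if "s > 0" for s
      using S1[of p q 1 s] S1[of "F1 s p" q "-1" s] pq that by (simp add: K_def)
    show "K (p, F2 s q) < K (p, q)" if "s > 0" for s
      using S2[of p "F2 s q" 1 s] S2[of p q "-1" s] pq that by (simp add: K_def)
    \<comment> \<open>Far back, \<open>S 1\<close> is below the value of \<open>S (-1)\<close> at
      \<open>(p, q)\<close>, and \<open>S (-1)\<close> has only increased on the way. The three
      other sign changes are mirror images.\<close>
    obtain s where "s > 0" "S 1 (F1 (- (1 * s)) p, q) < S (-1) (p, q)"
      using small[OF S3[of p q 1] Spos[of p q "-1"]] pq by auto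
    moreover from this have "S (-1) (p, q) < S (-1) (F1 (- s) p, q)"
      using S1[of p q "-1" s] pq by simp
    ultimately show "\<exists>s. K (F1 s p, q) < 0" by (intro exI[of _ "- s"]) (simp add: K_def)
    obtain s where "s > 0" "S (-1) (F1 (- (-1 * s)) p, q) < S 1 (p, q)"
      using small[OF S3[of p q "-1"] Spos[of p q 1]] pq by auto
    moreover from this have "S 1 (p, q) < S 1 (F1 s p, q)"
      using S1[of p q 1 s] pq by simp
    ultimately show "\<exists>s. 0 < K (F1 s p, q)" by (intro exI[of _ s]) (simp add: K_def)
    obtain s where "s > 0" "S 1 (p, F2 (1 * s) q) < S (-1) (p, q)"
      using small[OF S4[of p q 1] Spos[of p q "-1"]] pq by auto
    moreover from this have "S (-1) (p, q) < S (-1) (p, F2 s q)"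
      using S2[of p q "-1" s] pq by simp
    ultimately show "\<exists>s. K (p, F2 s q) < 0" by (intro exI[of _ s]) (simp add: K_def)
    obtain s where "s > 0" "S (-1) (p, F2 (-1 * s) q) < S 1 (p, q)"
      using small[OF S4[of p q "-1"] Spos[of p q 1]] pq by auto
    moreover from this have "S 1 (p, q) < S 1 (p, F2 (- s) q)"
      using S2[of p q 1 s] pq by simp
    ultimately show "\<exists>s. 0 < K (p, F2 s q)" by (intro exI[of _ "- s"]) (simp add: K_def)
  qed
qed

text \<open>The image \<open>h p\<close> is the zero of \<open>K\<close> over \<open>p\<close>. Sign
  change and strictness in \<open>q\<close> give its existence and uniqueness; in \<open>p\<close>
  they make \<open>h\<close> surjective and injective.\<close>

lemma imp_topologically_equivalent: "topologically_equivalent F1 F2"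
proof -
  obtain K :: "plane \<times> plane \<Rightarrow> real" where K: "continuous_on fibre_product K"
    and K1: "\<And>p q s. rel p q \<Longrightarrow> s > 0 \<Longrightarrow> K (p, q) < K (F1 s p, q)"
    and K2: "\<And>p q s. rel p q \<Longrightarrow> s > 0 \<Longrightarrow> K (p, F2 s q) < K (p, q)"
    and neg1: "\<And>p q. rel p q \<Longrightarrow> \<exists>s. K (F1 s p, q) < 0" and pos1: "\<And>p q. rel p q \<Longrightarrow> \<exists>s. 0 < K (F1 s p, q)"
    and neg2: "\<And>p q. rel p q \<Longrightarrow> \<exists>s. K (p, F2 s q) < 0" and pos2: "\<And>p q. rel p q \<Longrightarrow> \<exists>s. 0 < K (p, F2 s q)"
    by (rule exists_order_function) (rule that)
  have tendsto_K: "(\<lambda>n. K (u n, v n)) \<longlonglongrightarrow> K (p, q)"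
    if "u \<longlonglongrightarrow> p" "v \<longlonglongrightarrow> q" "\<And>n. rel (u n) (v n)" "rel p q" for u v p q
    using that by (intro continuous_on_tendsto_compose[OF K] tendsto_Pair) (auto simp: fibre_product_def)
  have ivt: "\<exists>s. k s = 0" if "continuous_on UNIV k" "k a < 0" "0 < k b" for k :: "real \<Rightarrow> real" and a b
  proof -
    have "connected (range k)" using that(1) by (intro connected_continuous_image) auto
    then have "0 \<in> range k" using that connected_contains_Icc[of "range k" "k a" "k b"] by fastforce
    then show ?thesis by auto
  qed
  have zero2: "\<exists>s. K (p, F2 s q) = 0" if pq: "rel p q" for p q
  proof -
    have "continuous_on UNIV (\<lambda>s. K (p, F2 s q))"
      using pq by (intro continuous_on_compose2[OF K] continuous_intros) (auto simp: fibre_product_def)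
    then show ?thesis using ivt neg2[OF pq] pos2[OF pq] by blast
  qed
  have zero1: "\<exists>s. K (F1 s p, q) = 0" if pq: "rel p q" for p q
  proof -
    have "continuous_on UNIV (\<lambda>s. K (F1 s p, q))"
      using pq by (intro continuous_on_compose2[OF K] continuous_intros) (auto simp: fibre_product_def)
    then show ?thesis using ivt neg1[OF pq] pos1[OF pq] by blast
  qed
  have eq1: "s = 0" if "rel p q" "K (F1 s p, q) = K (p, q)" for p q s
    using K1[OF that(1), of s] K1[of "F1 s p" q "- s"] that by (cases s "0 :: real" rule: linorder_cases) auto
  have eq2: "s = 0" if "rel p q" "K (p, F2 s q) = K (p, q)" for p q s
    using K2[OF that(1), of s] K2[of p "F2 s q" "- s"] that by (cases s "0 :: real" rule: linorder_cases) auto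
  have cmp2: "s < 0" if "rel p q" "K (p, q) < K (p, F2 s q)" for p q s
  proof (rule ccontr)
    assume "\<not> s < 0"
    then show False using K2[OF that(1), of s] that(2) by (cases "s = 0") auto
  qed
  have cmp2': "0 < s" if "rel p q" "K (p, F2 s q) < K (p, q)" for p q s
    using cmp2[of p "F2 s q" "- s"] that by simp
  have "\<forall>p. \<exists>q. rel p q \<and> K (p, q) = 0"
  proof
    fix p
    obtain q where "rel p q" by (rule rel_total)
    then show "\<exists>q. rel p q \<and> K (p, q) = 0" using zero2[of p q] rel_flow(2) by blast
  qed
  then obtain h where h: "\<And>p. rel p (h p)" "\<And>p. K (p, h p) = 0" by metis
  have h_unique: "q = h p" if q: "rel p q" "K (p, q) = 0" for p q
  proof -
    have "orbit F2 (h p) = orbit F2 q" using rel_fun q(1) h(1) by blast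
    then obtain s where s: "q = F2 s (h p)" by (rule B.orbit_eqE)
    have "K (p, F2 s (h p)) = K (p, h p)" using h(2)[of p] q(2) unfolding s by simp
    then have "s = 0" using eq2 h(1) by blast
    then show ?thesis using s by simp
  qed
  have orb: "orbit F2 (h (F1 t x)) = orbit F2 (h x)" for t x
    using h(1)[of "F1 t x"] h(1)[of x] rel_fun by simp
  have "inj h"
  proof (rule injI)
    fix p p' assume eq: "h p = h p'"
    have "orbit F1 p = orbit F1 p'" using h(1)[of p] h(1)[of p'] rel_inj eq by metis
    then obtain s where s: "p' = F1 s p" by (rule A.orbit_eqE)
    have "K (F1 s p, h p) = K (p, h p)" using h(2)[of p] h(2)[of p'] unfolding eq s by simp
    then have "s = 0" using eq1 h(1) by blast
    then show "p = p'" using s by simp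
  qed
  have "surj h"
  proof -
    have "\<exists>p. q = h p" for q
    proof -
      obtain p where p: "rel p q" by (rule rel_surj)
      then obtain s where "K (F1 s p, q) = 0" using zero1 by blast
      then have "q = h (F1 s p)" using p by (intro h_unique) auto
      then show ?thesis by blast
    qed
    then show ?thesis by (auto simp: surj_def)
  qed
  have cont_h: "continuous_on UNIV h"
    unfolding continuous_on_sequentially
  proof (intro allI ballI impI)
    fix f :: "nat \<Rightarrow> plane" and p assume f: "(\<forall>n. f n \<in> UNIV) \<and> f \<longlonglongrightarrow> p"
    obtain \<sigma> \<rho> where ps: "paired_sections \<sigma> \<rho>" and base: "\<sigma> 0 = p" "\<rho> 0 = h p"
      using exists_paired_sections[OF h(1)] by metis
    have cs: "A.cross_section \<sigma>" "B.cross_section \<rho>" and r: "rel (\<sigma> x) (\<rho> x)" for x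
      using ps by (auto simp: paired_sections_def)
    have pt: "p \<in> A.tube \<sigma>" using A.tubeI(2)[of \<sigma> 0] base by simp
    note tA = A.tendsto_coords[OF cs(1) conjunct2[OF f] pt]
    define X where "X n = A.xcoord \<sigma> (f n)" for n
    have X: "X \<longlonglongrightarrow> 0" using tA(1) A.coord_section(1)[OF cs(1), of 0] by (simp add: X_def[abs_def] base)
    obtain N where N: "\<And>n. n \<ge> N \<Longrightarrow> f n \<in> A.tube \<sigma>" using tA(3) by (auto simp: eventually_sequentially)
    have rX: "rel (f n) (\<rho> (X n))" if "n \<ge> N" for n
      using r[of "X n"] A.orbit_xcoord[OF cs(1) N[OF that]] rel_mono unfolding X_def by metis
    have K_lim: "(\<lambda>n. K (f (n + N), F2 s (\<rho> (X (n + N))))) \<longlonglongrightarrow> K (p, F2 s (h p))" for s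
    proof (rule tendsto_K)
      show "(\<lambda>n. f (n + N)) \<longlonglongrightarrow> p" using f LIMSEQ_ignore_initial_segment by blast
      have "(\<lambda>n. F2 s (\<rho> (X n))) \<longlonglongrightarrow> F2 s (\<rho> 0)"
        by (intro B.tendsto_flow tendsto_const B.tendsto_section[OF cs(2)] X)
      then show "(\<lambda>n. F2 s (\<rho> (X (n + N)))) \<longlonglongrightarrow> F2 s (h p)"
        unfolding base by (rule LIMSEQ_ignore_initial_segment)
    qed (use rX h in auto)
    define T where "T n = B.tcoord \<rho> (h (f n))" for n
    have hf: "h (f n) = F2 (T n) (\<rho> (X n))" if "n \<ge> N" for n
      using B.tube_cases[OF cs(2) paired_tube(1)[OF ps h(1) N[OF that]]]
        paired_tube(2)[OF ps h(1) N[OF that]] unfolding T_def X_def by metis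
    have "(\<lambda>n. T (n + N)) \<longlonglongrightarrow> 0"
    proof (rule LIMSEQ_I)
      fix e :: real assume e: "e > 0"
      \<comment> \<open>The strict signs at times \<open>e\<close> and \<open>-e\<close> persist for
        nearby points, and monotonicity in \<open>q\<close> locks the zero between these
        times.\<close>
      have "K (p, F2 e (h p)) < 0" using K2[OF h(1) e, of p] h(2)[of p] by simp
      moreover have "0 < K (p, F2 (- e) (h p))"
        using K2[of p "F2 (- e) (h p)" e] e h by simp
      ultimately have "eventually (\<lambda>n. K (f (n + N), F2 e (\<rho> (X (n + N)))) < 0 \<and>
          0 < K (f (n + N), F2 (- e) (\<rho> (X (n + N))))) sequentially"
        using order_tendstoD(2)[OF K_lim] order_tendstoD(1)[OF K_lim] by (intro eventually_conj) auto
      then obtain M where M: "\<And>n. n \<ge> M \<Longrightarrow> K (f (n + N), F2 e (\<rho> (X (n + N)))) < 0"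
          "\<And>n. n \<ge> M \<Longrightarrow> 0 < K (f (n + N), F2 (- e) (\<rho> (X (n + N))))"
        unfolding eventually_sequentially by blast
      show "\<exists>M. \<forall>n\<ge>M. norm (T (n + N) - 0) < e"
      proof (intro exI[of _ M] allI impI)
        fix n assume n: "n \<ge> M"
        let ?p = "f (n + N)" and ?q = "h (f (n + N))"
        have q: "?q = F2 (T (n + N)) (\<rho> (X (n + N)))" by (rule hf) simp
        have "K (?p, F2 (e - T (n + N)) ?q) < K (?p, ?q)"
          using M(1)[OF n] h(2)[of ?p] by (subst q) simp
        then have "0 < e - T (n + N)" using cmp2' h(1) by blast
        moreover have "K (?p, ?q) < K (?p, F2 (- e - T (n + N)) ?q)"
          using M(2)[OF n] h(2)[of ?p] by (subst (2) q) simp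
        then have "- e - T (n + N) < 0" using cmp2 h(1) by blast
        ultimately show "norm (T (n + N) - 0) < e" by simp
      qed
    qed
    then have T: "T \<longlonglongrightarrow> 0" using LIMSEQ_offset by blast
    have "(\<lambda>n. F2 (T n) (\<rho> (X n))) \<longlonglongrightarrow> F2 0 (\<rho> 0)"
      by (intro B.tendsto_flow T B.tendsto_section[OF cs(2)] X)
    moreover have "eventually (\<lambda>n. F2 (T n) (\<rho> (X n)) = (h \<circ> f) n) sequentially"
      unfolding eventually_sequentially o_def using hf[symmetric] by blast
    ultimately have "(h \<circ> f) \<longlonglongrightarrow> F2 0 (\<rho> 0)" by (rule Lim_transform_eventually)
    then show "(h \<circ> f) \<longlonglongrightarrow> h p" by (simp add: base)
  qed
  obtain g where g: "homeomorphism UNIV UNIV h g"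
    using invariance_of_domain_homeomorphism[OF open_UNIV cont_h _ \<open>inj h\<close>] \<open>surj h\<close> by auto
  have "h ` s \<in> orbits F2" if s: "s \<in> orbits F1" for s
  proof -
    obtain x where x: "s = orbit F1 x" using s by (auto simp: orbits_def)
    have "h ` orbit F1 x = orbit F2 (h x)"
    proof
      show "h ` orbit F1 x \<subseteq> orbit F2 (h x)"
        using orb by (auto elim!: A.mem_orbitE simp: B.mem_orbit_iff)
      show "orbit F2 (h x) \<subseteq> h ` orbit F1 x"
      proof
        fix q assume "q \<in> orbit F2 (h x)"
        then have q: "orbit F2 q = orbit F2 (h x)" by (simp add: B.mem_orbit_iff)
        obtain p where p: "q = h p" using \<open>surj h\<close> by blast
        have "rel x (h p)" using q p rel_fun h(1) by blast
        then have "p \<in> orbit F1 x" using rel_inj h(1) by (metis A.mem_orbit_iff)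
        then show "q \<in> h ` orbit F1 x" using p by blast
      qed
    qed
    then show ?thesis using x by (simp add: orbits_def)
  qed
  moreover have "preserves_orbit_orientation F1 F2 h"
    unfolding preserves_orbit_orientation_def
  proof
    fix x
    obtain \<rho> where \<rho>: "B.cross_section \<rho>" "\<rho> 0 = h x" by (rule B.exists_cross_section)
    \<comment> \<open>Reading the time change off as a tube coordinate makes its continuity
      immediate.\<close>
    define \<tau> where "\<tau> t = B.tcoord \<rho> (h (F1 t x))" for t
    have ht: "h (F1 t x) = F2 (\<tau> t) (h x)" for t
    proof -
      obtain s where "h (F1 t x) = F2 s (h x)" using B.orbit_eqE[OF orb[of t x, symmetric]] by blast
      then show ?thesis using B.coord_flow(2)[OF \<rho>(1), of s 0] \<rho>(2) by (simp add: \<tau>_def)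
    qed
    have tube: "h (F1 t x) \<in> B.tube \<rho>" for t
      using ht B.tubeI(1)[of "\<tau> t" \<rho> 0] \<rho>(2) by simp
    have "continuous_on UNIV \<tau>"
      unfolding \<tau>_def using tube
      by (intro continuous_on_compose2[OF B.continuous_coords(2)[OF \<rho>(1)]]
          continuous_on_compose2[OF cont_h] continuous_intros) auto
    moreover have "strict_mono \<tau>"
    proof (rule strict_monoI)
      fix t t' :: real assume "t < t'"
      \<comment> \<open>Advancing \<open>p\<close> makes \<open>K\<close> positive at the old image
        point, and to return to zero \<open>q\<close> has to move forwards.\<close>
      then have "K (F1 t x, h (F1 t x)) < K (F1 t' x, h (F1 t x))"
        using K1[OF h(1), of "t' - t" "F1 t x"] by simp
      moreover have "h (F1 t' x) = F2 (\<tau> t' - \<tau> t) (h (F1 t x))" using ht[of t] ht[of t'] by simp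
      ultimately have "K (F1 t' x, F2 (\<tau> t' - \<tau> t) (h (F1 t x))) < K (F1 t' x, h (F1 t x))"
        using h(2)[of "F1 t x"] h(2)[of "F1 t' x"] by simp
      moreover have "rel (F1 t' x) (h (F1 t x))" using h(1)[of "F1 t x"] by simp
      ultimately have "0 < \<tau> t' - \<tau> t" using cmp2' by blast
      then show "\<tau> t < \<tau> t'" by simp
    qed
    ultimately show "\<exists>\<tau>. continuous_on UNIV \<tau> \<and> strict_mono \<tau> \<and> (\<forall>t. h (F1 t x) = F2 (\<tau> t) (h x))"
      using ht by blast
  qed
  ultimately show ?thesis
    unfolding topologically_equivalent_def using g by blast
qed

end

section \<open>Invariance under topological equivalence\<close>

lemma saturatedI:
  assumes "\<And>p. p \<in> A \<Longrightarrow> orbit F p \<subseteq> A" "\<And>p. p \<in> A \<Longrightarrow> p \<in> orbit F p"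
  shows "saturated F A"
  unfolding saturated_def
proof (intro exI conjI)
  show "orbit F ` A \<subseteq> orbits F" by (auto simp: orbits_def)
  show "A = \<Union>(orbit F ` A)" using assms by blast
qed

text \<open>Stated for any two regular flows, so that it serves a homeomorphism and its inverse
  alike. Saturated neighbourhoods are pulled back by \<open>h\<close>, approximating segments are
  pushed forward.\<close>

lemma orbit_succ_image:
  assumes "regular_flow F" "regular_flow G" and hg: "homeomorphism UNIV UNIV h g"
    and img: "\<And>x. h ` orbit F x = orbit G (h x)"
    and fwd: "\<And>x t. t \<ge> 0 \<Longrightarrow> h (F t x) \<in> forward_orbit G (h x)"
    and succ: "orbit_succ F s1 s2"
  shows "orbit_succ G (h ` s1) (h ` s2)"
proof -
  interpret F: regular_plane_flow F by standard fact
  interpret G: regular_plane_flow G by standard fact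
  have cont: "continuous_on UNIV h" and inv: "\<And>x. g (h x) = x"
    using hg by (auto simp: homeomorphism_def)
  have orb: "h ` s \<in> orbits G" if "s \<in> orbits F" for s
    using that img by (auto simp: orbits_def)
  have pull: "saturated_nbhd F s (h -` N)" if "saturated_nbhd G (h ` s) N" for s N
  proof -
    obtain U where U: "open U" "h ` s \<subseteq> U" "U \<subseteq> N" and sat: "saturated G N"
      using \<open>saturated_nbhd G (h ` s) N\<close> unfolding saturated_nbhd_def by blast
    have "saturated F (h -` N)"
    proof (rule saturatedI)
      show "orbit F p \<subseteq> h -` N" if p: "p \<in> h -` N" for p
      proof
        fix x assume "x \<in> orbit F p"
        then have "h x \<in> orbit G (h p)" using img by blast
        then obtain t where "h x = G t (h p)" by (rule G.mem_orbitE)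
        then show "x \<in> h -` N" using p G.saturated_flow[OF sat] by simp
      qed
    qed simp
    moreover have "open (h -` U)" "s \<subseteq> h -` U" "h -` U \<subseteq> h -` N"
      using U cont by (auto intro: open_vimage)
    ultimately show ?thesis unfolding saturated_nbhd_def by blast
  qed
  have "s1 \<noteq> s2" using succ by (auto simp: orbit_succ_def inseparable_def)
  then have "h ` s1 \<noteq> h ` s2" using inv by (metis inj_image_eq_iff inj_on_inverseI)
  moreover have "N1 \<inter> N2 \<noteq> {}" if "saturated_nbhd G (h ` s1) N1" "saturated_nbhd G (h ` s2) N2" for N1 N2
  proof -
    have "h -` N1 \<inter> h -` N2 \<noteq> {}"
      using succ pull[OF that(1)] pull[OF that(2)] unfolding orbit_succ_def inseparable_def by blast
    then show ?thesis by blast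
  qed
  moreover obtain p q where pq: "p \<in> s1" "q \<in> s2" "(p, q) \<in> prolongation F"
    using succ unfolding orbit_succ_def by blast
  moreover have "(h p, h q) \<in> prolongation G"
  proof -
    obtain f t where f: "f \<longlonglongrightarrow> p" "(\<lambda>n. F (t n) (f n)) \<longlonglongrightarrow> q" "\<And>n. t n \<ge> 0"
      using F.prolongation_sequences[OF pq(3)] by blast
    have "(\<lambda>n. (h (f n), h (F (t n) (f n)))) \<longlonglongrightarrow> (h p, h q)"
      by (intro tendsto_Pair continuous_on_tendsto_compose[OF cont] f) auto
    then show ?thesis
      unfolding prolongation_def closure_sequential
      using fwd f(3) by (intro exI[of _ "\<lambda>n. (h (f n), h (F (t n) (f n)))"]) simp
  qed
  ultimately show ?thesis
    using succ orb unfolding orbit_succ_def inseparable_def by blast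
qed

text \<open>The universal property of the quotient map \<open>orbit F\<close> reduces the claim to
  continuity of \<open>orbit G \<circ> h\<close>.\<close>

lemma continuous_map_orbit_image:
  assumes "continuous_on UNIV h" "\<And>x. h ` orbit F x = orbit G (h x)"
  shows "continuous_map (orbit_space F) (orbit_space G) ((`) h)"
proof -
  have "continuous_map euclidean (orbit_space G) (orbit G \<circ> h)"
    using assms(1) quotient_imp_continuous_map[OF quotient_map_orbit]
    by (intro continuous_map_compose[of _ euclidean]) auto
  moreover have "orbit G \<circ> h = (`) h \<circ> orbit F" using assms(2) by auto
  ultimately show ?thesis
    using continuous_compose_quotient_map_eq[OF quotient_map_orbit[of F]] by metis
qed

theorem theorem3:
  fixes F1 F2 :: "real \<Rightarrow> plane \<Rightarrow> plane"
  assumes "regular_flow F1" and "regular_flow F2"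
  shows "topologically_equivalent F1 F2 \<longleftrightarrow>
    (\<exists>\<phi>. homeomorphic_map (orbit_space F1) (orbit_space F2) \<phi> \<and>
       (\<forall>x1 x2. orbit_succ F1 (orbit F1 x1) (orbit F1 x2) \<longleftrightarrow>
                 orbit_succ F2 (\<phi> (orbit F1 x1)) (\<phi> (orbit F1 x2))))"
    (is "?L \<longleftrightarrow> ?R")
proof
  assume ?R
  then obtain \<phi> where "homeomorphic_map (orbit_space F1) (orbit_space F2) \<phi>"
      "\<And>x1 x2. orbit_succ F1 (orbit F1 x1) (orbit F1 x2) \<longleftrightarrow>
        orbit_succ F2 (\<phi> (orbit F1 x1)) (\<phi> (orbit F1 x2))" by blast
  then interpret orbit_space_iso F1 F2 \<phi>
    using assms by unfold_locales auto
  show ?L by (rule imp_topologically_equivalent)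
next
  interpret A: regular_plane_flow F1 by standard fact
  interpret B: regular_plane_flow F2 by standard fact
  assume ?L
  then obtain h g where hg: "homeomorphism UNIV UNIV h g"
    and orb: "\<And>s. s \<in> orbits F1 \<Longrightarrow> h ` s \<in> orbits F2"
    and orient: "preserves_orbit_orientation F1 F2 h"
    unfolding topologically_equivalent_def by blast
  have gh: "continuous_on UNIV h" "continuous_on UNIV g" "\<And>x. g (h x) = x" "\<And>y. h (g y) = y"
    using hg by (auto simp: homeomorphism_def)
  have h_img: "h ` orbit F1 x = orbit F2 (h x)" for x
  proof -
    have "h ` orbit F1 x \<in> orbits F2" by (rule orb) (simp add: orbits_def)
    then obtain y where y: "h ` orbit F1 x = orbit F2 y" by (auto simp: orbits_def)
    then have "h x \<in> orbit F2 y" using A.orbit_self by blast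
    then show ?thesis using y by (simp add: B.mem_orbit_iff)
  qed
  have g_img: "g ` orbit F2 y = orbit F1 (g y)" for y
  proof -
    have "orbit F2 y = h ` orbit F1 (g y)" by (simp add: h_img gh)
    then show ?thesis by (simp add: image_image gh)
  qed
  have time: "\<exists>s. h (F1 t x) = F2 s (h x) \<and> (0 \<le> s \<longleftrightarrow> 0 \<le> t)" for t x
  proof -
    obtain \<tau> :: "real \<Rightarrow> real" where \<tau>: "strict_mono \<tau>" "\<And>t. h (F1 t x) = F2 (\<tau> t) (h x)"
      using orient unfolding preserves_orbit_orientation_def by blast
    \<comment> \<open>A priori \<open>\<tau> 0\<close> is only a period of \<open>h x\<close>; the
      absence of periodic orbits makes it \<open>0\<close>, so that \<tau> keeps the sign of
      times.\<close>
    have "F2 (\<tau> 0) (h x) = h x" using \<tau>(2)[of 0] by simp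
    then have "\<tau> 0 = 0" by (simp add: B.no_periodic)
    then have "0 \<le> \<tau> t \<longleftrightarrow> 0 \<le> t" using strict_mono_less_eq[OF \<tau>(1), of 0 t] by simp
    then show ?thesis using \<tau>(2) by blast
  qed
  have h_fwd: "h (F1 t x) \<in> forward_orbit F2 (h x)" if "t \<ge> 0" for t x
    using time[of t x] that by (auto simp: forward_orbit_def)
  have g_fwd: "g (F2 s y) \<in> forward_orbit F1 (g y)" if "s \<ge> 0" for s y
  proof -
    have "g (F2 s y) \<in> orbit F1 (g y)" using g_img[of y] by (metis B.flow_in_orbit imageI)
    then obtain t where t: "g (F2 s y) = F1 t (g y)" by (rule A.mem_orbitE)
    obtain r where r: "h (F1 t (g y)) = F2 r (h (g y))" "0 \<le> r \<longleftrightarrow> 0 \<le> t" using time by blast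
    \<comment> \<open>Times along an orbit are unique, so \<open>r = s\<close>, and the sign of
      \<open>s\<close> passes to \<open>t\<close>.\<close>
    have "F2 s y = F2 r y" using r(1) by (simp add: gh flip: t)
    then have "t \<ge> 0" using r(2) that by (simp add: B.flow_inj)
    then show ?thesis using t by (auto simp: forward_orbit_def)
  qed
  have "homeomorphic_maps (orbit_space F1) (orbit_space F2) ((`) h) ((`) g)"
    unfolding homeomorphic_maps_def
    using continuous_map_orbit_image[of h F1 F2] continuous_map_orbit_image[of g F2 F1] gh h_img g_img
    by (simp add: image_image)
  then have "homeomorphic_map (orbit_space F1) (orbit_space F2) ((`) h)"
    by (rule homeomorphic_maps_imp_map)
  moreover have "orbit_succ F1 s1 s2 \<longleftrightarrow> orbit_succ F2 (h ` s1) (h ` s2)" for s1 s2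
  proof
    show "orbit_succ F2 (h ` s1) (h ` s2)" if "orbit_succ F1 s1 s2"
      using orbit_succ_image[OF assms hg h_img h_fwd that] .
    assume *: "orbit_succ F2 (h ` s1) (h ` s2)"
    have "orbit_succ F1 (g ` h ` s1) (g ` h ` s2)"
      using orbit_succ_image[OF assms(2,1) homeomorphism_symD[OF hg] g_img g_fwd *] .
    then show "orbit_succ F1 s1 s2" by (simp add: image_image gh)
  qed
  ultimately show ?R by blast
qed

end
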